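(* Let $Q\in o(n+1)$ be such that $I+Q^2$ is positive definite, let $V(x)=Qx$ for $x\in\mathbb S^n$, and let $F_Q$ be the Randers metric on $\mathbb S^n$ with navigation datum $(h,V)$. Then the unit speed geodesic $\gamma(s)$ on $(\mathbb S^n,F_Q)$ satisfying $\gamma(0)=x\in\mathbb S^n$ and $\dot\gamma(0)=X\in T_x\mathbb S^n$ can be expressed as $$\gamma(s)=\exp(sQ)\big((\cos s)\,x+(\sin s)\,(X-V(x))\big).$$
   Context: $\mathbb S^n\subset\mathbb R^{n+1}$ is the unit sphere (points are column vectors), $h$ its standard round metric, $o(n+1)$ the real skew-symmetric $(n+1)\times(n+1)$ matrices, $\exp$ the matrix exponential. The condition that $I+Q^2$ is positive definite is equivalent to $|V|_h<1$ on $\mathbb S^n$. $F_Q$ is the Finsler metric on $\mathbb S^n$ determined, for $y\in T_x\mathbb S^n\setminus\{0\}$, by $F_Q(x,y)>0$ and $|y-F_Q(x,y)V(x)|_h=F_Q(x,y)$. Unit speed means $F_Q(\gamma,\dot\gamma)=1$ (in particular $F_Q(x,X)=1$). Geodesics of a Finsler metric $F$ are the solutions of $\ddot x^i+2G^i(x,\dot x)=0$, with $G^i=\frac{g^{il}}4\{[F^2]_{x^ky^l}y^k-[F^2]_{x^l}\}$, $g_{ij}=\frac12[F^2]_{y^iy^j}$. Here $s$ ranges over $\mathbb R$. *)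

theory Defs
  imports "HOL-Analysis.Analysis"
begin

text \<open>The ambient space of \<open>S\<^sup>n\<close> is \<open>real ^ ('n + 1)\<close> with \<open>n = CARD('n)\<close>, so that charts of
  \<open>S\<^sup>n = sphere 0 1\<close> are modelled on \<open>real ^ 'n\<close>. The tangent space at \<open>x\<close> is realised as a
  subspace of the ambient space, and the round metric is the restricted Euclidean inner product.\<close>

definition tangent_sphere :: "real ^ 'm \<Rightarrow> (real ^ 'm) set" where
  "tangent_sphere x = {y. x \<bullet> y = 0}"

definition positive_definite :: "real ^ 'm ^ 'm \<Rightarrow> bool" where
  "positive_definite A \<longleftrightarrow> transpose A = A \<and> (\<forall>v. v \<noteq> 0 \<longrightarrow> v \<bullet> (A *v v) > 0)"

definition matrix_exp :: "real ^ 'm ^ 'm \<Rightarrow> real ^ 'm ^ 'm" where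
  "matrix_exp A = (\<Sum>k. (1 / fact k) *\<^sub>R (((**) A) ^^ k) (mat 1))"


subsection \<open>Metrics from navigation data\<close>

definition navigation_metric :: "(real ^ 'm \<Rightarrow> real ^ 'm) \<Rightarrow> real ^ 'm \<Rightarrow> real ^ 'm \<Rightarrow> real" where
  "navigation_metric V x y =
     (if y = 0 then 0 else (THE f. f > 0 \<and> norm (y - f *\<^sub>R V x) = f))"

lemma navigation_metric_ex1:
  fixes w y :: "'a :: real_normed_vector"
  assumes w: "norm w < 1" and y: "y \<noteq> 0"
  shows "\<exists>!f. f > 0 \<and> norm (y - f *\<^sub>R w) = f"
proof -
  have unique: "\<not> f < f'" if f: "norm (y - f *\<^sub>R w) = f" and f': "norm (y - f' *\<^sub>R w) = f'" for f f'
  proof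
    assume less: "f < f'"
    have "f' = norm ((y - f *\<^sub>R w) - (f' - f) *\<^sub>R w)"
      by (subst f' [symmetric]) (simp add: algebra_simps)
    also have "\<dots> \<le> f + (f' - f) * norm w"
      using norm_triangle_ineq4 [of "y - f *\<^sub>R w" "(f' - f) *\<^sub>R w"] f less by simp
    also have "\<dots> < f + (f' - f) * 1"
      using w less by (intro add_strict_left_mono mult_strict_left_mono) auto
    finally show False by simp
  qed
  define b where "b = norm y / (1 - norm w)"
  have b: "b > 0" "b * (1 - norm w) = norm y"
    using w y by (auto simp: b_def)
  have "norm (y - b *\<^sub>R w) \<le> b"
    using norm_triangle_ineq4 [of y "b *\<^sub>R w"] b by (simp add: algebra_simps)
  moreover have "continuous_on {0..b} (\<lambda>f. f - norm (y - f *\<^sub>R w))"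
    by (intro continuous_intros)
  ultimately obtain f where f: "0 \<le> f" "f - norm (y - f *\<^sub>R w) = 0"
    using IVT' [of "\<lambda>f. f - norm (y - f *\<^sub>R w)" 0 0 b] b y by auto
  moreover from f y have "f \<noteq> 0" by auto
  ultimately have "f > 0 \<and> norm (y - f *\<^sub>R w) = f" by auto
  then show ?thesis
    using unique by (metis linorder_neqE)
qed


subsection \<open>Smooth charts of the sphere\<close>

primrec Ck_on :: "nat \<Rightarrow> 'a :: euclidean_space set \<Rightarrow> ('a \<Rightarrow> 'b :: euclidean_space) \<Rightarrow> bool" where
  "Ck_on 0 U f \<longleftrightarrow> continuous_on U f"
| "Ck_on (Suc k) U f \<longleftrightarrow>
     (\<forall>x\<in>U. f differentiable (at x)) \<and> (\<forall>v. Ck_on k U (\<lambda>x. frechet_derivative f (at x) v))"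

definition smooth_on :: "'a :: euclidean_space set \<Rightarrow> ('a \<Rightarrow> 'b :: euclidean_space) \<Rightarrow> bool" where
  "smooth_on U f \<longleftrightarrow> (\<forall>k. Ck_on k U f)"

text \<open>Charts are given by their inverses, i.e. as local parametrisations \<open>\<phi>\<close> of the sphere.\<close>

definition sphere_chart :: "(real ^ 'n::finite) set \<Rightarrow> (real ^ 'n \<Rightarrow> real ^ ('n::finite + 1)) \<Rightarrow> bool" where
  "sphere_chart U \<phi> \<longleftrightarrow>
     open U \<and> smooth_on U \<phi> \<and>
     (\<forall>u\<in>U. inj (frechet_derivative \<phi> (at u))) \<and>
     openin (top_of_set (sphere 0 1)) (\<phi> ` U) \<and>
     homeomorphism U (\<phi> ` U) \<phi> (inv_into U \<phi>)"


subsection \<open>Geodesics of a Finsler metric\<close>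

definition partial_deriv :: "'n \<Rightarrow> (real ^ 'n \<Rightarrow> real) \<Rightarrow> real ^ 'n \<Rightarrow> real" where
  "partial_deriv i f u = deriv (\<lambda>t. f (u + t *\<^sub>R axis i 1)) 0"

text \<open>In the next two definitions \<open>F u y\<close> is a Finsler metric on an open subset of \<open>real ^ 'n\<close>:
  \<open>fundamental_tensor\<close> is \<open>(g\<^sub>i\<^sub>j)\<close> and \<open>spray_coeff\<close> is \<open>(G\<^sup>i)\<close>, both at \<open>(u, y)\<close>. They are only
  meaningful for \<open>y \<noteq> 0\<close>.\<close>

definition fundamental_tensor ::
    "(real ^ 'n \<Rightarrow> real ^ 'n \<Rightarrow> real) \<Rightarrow> real ^ 'n \<Rightarrow> real ^ 'n \<Rightarrow> real ^ 'n ^ 'n" where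
  "fundamental_tensor F u y =
     (\<chi> i j. 1 / 2 * partial_deriv j (\<lambda>w. partial_deriv i (\<lambda>w'. (F u w')\<^sup>2) w) y)"

definition spray_coeff ::
    "(real ^ 'n \<Rightarrow> real ^ 'n \<Rightarrow> real) \<Rightarrow> real ^ 'n \<Rightarrow> real ^ 'n \<Rightarrow> real ^ 'n" where
  "spray_coeff F u y =
     (\<chi> i. \<Sum>l\<in>UNIV. matrix_inv (fundamental_tensor F u y) $ i $ l / 4 *
        ((\<Sum>k\<in>UNIV. partial_deriv l (\<lambda>w. partial_deriv k (\<lambda>z. (F z w)\<^sup>2) u) y * y $ k)
           - partial_deriv l (\<lambda>z. (F z y)\<^sup>2) u))"

definition chart_metric ::
    "(real ^ 'm \<Rightarrow> real ^ 'm \<Rightarrow> real) \<Rightarrow> (real ^ 'n \<Rightarrow> real ^ 'm) \<Rightarrow> real ^ 'n \<Rightarrow> real ^ 'n \<Rightarrow> real" where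
  "chart_metric F \<phi> u y = F (\<phi> u) (frechet_derivative \<phi> (at u) y)"

text \<open>The geodesic equation is required in every smooth chart, for the coordinate curve \<open>c\<close> with
  velocity \<open>v\<close> and acceleration \<open>a\<close>, at all times at which the curve is in the chart domain
  (an open set of times, by continuity).\<close>

definition sphere_geodesic ::
    "(real ^ ('n::finite + 1) \<Rightarrow> real ^ ('n::finite + 1) \<Rightarrow> real) \<Rightarrow> (real \<Rightarrow> real ^ ('n::finite + 1)) \<Rightarrow> bool" where
  "sphere_geodesic F \<gamma> \<longleftrightarrow>
     continuous_on UNIV \<gamma> \<and> range \<gamma> \<subseteq> sphere 0 1 \<and>
     (\<forall>(U :: (real ^ 'n) set) \<phi>. sphere_chart U \<phi> \<longrightarrow>
        (let c = (\<lambda>s. inv_into U \<phi> (\<gamma> s)) in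
         \<exists>v a. \<forall>s. \<gamma> s \<in> \<phi> ` U \<longrightarrow>
           (c has_vector_derivative v s) (at s) \<and>
           (v has_vector_derivative a s) (at s) \<and>
           (\<forall>i. a s $ i + 2 * spray_coeff (chart_metric F \<phi>) (c s) (v s) $ i = 0)))"

definition unit_speed ::
    "(real ^ 'm \<Rightarrow> real ^ 'm \<Rightarrow> real) \<Rightarrow> (real \<Rightarrow> real ^ 'm) \<Rightarrow> bool" where
  "unit_speed F \<gamma> \<longleftrightarrow>
     (\<forall>s. \<gamma> differentiable (at s) \<and> F (\<gamma> s) (vector_derivative \<gamma> (at s)) = 1)"

end

theory Submission imports Defs
begin

text \<open>
  Let \<open>F = F\<^sub>Q\<close>, \<open>L = F\<^sup>2\<close>, and write \<open>W = y - F V\<close> for the velocity \<open>y\<close> relative to the wind, so that the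
  defining equation of \<open>F\<close> is \<open>\<bar>W\<bar> = F\<close>. Implicit differentiation gives \<open>dL = 2 M \<bullet> (dy - F dV)\<close> with
  the momentum \<open>M = F W / (F + W \<bullet> V)\<close>, and a second differentiation in \<open>y\<close> shows that the fundamental
  tensor is positive definite (\<open>nav_momentum_derivative_pos\<close>). Multiplying by it turns the geodesic
  equation in any chart into the Euler-Lagrange equation of \<open>L\<close>
  (\<open>spray_eq_iff_Euler_Lagrange\<close>, \<open>navigation_spray_iff\<close>).

  Along a unit speed curve \<open>\<gamma>\<close> the partial derivatives of the chart cancel in this equation, because
  second derivatives commute. As \<open>Q\<close> is skew, what remains says that \<open>M' - Q M\<close> is normal to the
  sphere, where now \<open>W = \<gamma>' - Q \<gamma>\<close> is a unit tangent vector and \<open>M = W / (1 + W \<bullet> Q \<gamma>)\<close>. Pairing with \<open>W\<close> shows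
  that \<open>1 + W \<bullet> Q \<gamma>\<close> is constant, and pairing with \<open>\<gamma>\<close> determines the normal component. So a unit
  speed curve is a geodesic if and only if \<open>\<gamma>' = Q \<gamma> + W\<close> and \<open>W' = Q W - \<gamma>\<close>
  (\<open>spray_iff_acceleration\<close>). In the frame rotating with \<open>exp (s Q)\<close> this linear system is the
  equation \<open>\<beta>'' = - \<beta>\<close> of a great circle, which gives the formula. Solutions with equal initial values
  agree, because \<open>\<bar>\<gamma>\<bar>\<^sup>2 + \<bar>W\<bar>\<^sup>2\<close> is conserved (\<open>skew_oscillator_unique\<close>).

  Two facts connect this with the definition of a geodesic through all charts. The coordinates
  of a twice differentiable curve on the sphere are twice differentiable in every chart
  (\<open>chart_coordinates_twice_differentiable\<close>), and every point lies in some chart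
  (\<open>stereographic_chart\<close>), so that the equations in the charts determine the acceleration everywhere.
\<close>

section \<open>Symmetry of second derivatives\<close>

text \<open>The mean value theorem along \<open>h\<close> reduces the second difference to an increment of the
  derivative in direction \<open>h\<close>, which its differentiability at \<open>x\<close> controls.\<close>

lemma second_difference_tendsto:
  fixes f :: "'a::real_normed_vector \<Rightarrow> real"
  assumes S: "open S" "x \<in> S"
    and f': "\<And>z. z \<in> S \<Longrightarrow> (f has_derivative f' z) (at z)"
    and f'': "((\<lambda>z. f' z h) has_derivative f'' h) (at x)"
  shows "((\<lambda>t. (f (x + t *\<^sub>R h + t *\<^sub>R k) - f (x + t *\<^sub>R h) - f (x + t *\<^sub>R k) + f x) / t\<^sup>2)
           \<longlongrightarrow> f'' h k) (at_right 0)"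
proof (rule tendstoI)
  fix e :: real assume e: "e > 0"
  define C where "C = 2 * norm h + norm k + 1"
  have C: "C > 0" "C \<ge> 1" unfolding C_def by (auto intro: add_nonneg_pos)
  define e' where "e' = e / (4 * C)"
  have e': "e' > 0" using e C by (simp add: e'_def)
  have lin: "linear (f'' h)"
    using f'' has_derivative_linear by blast
  from has_derivative_at_alt[THEN iffD1, OF f''] e' obtain d1 where d1: "d1 > 0"
    "\<And>z. norm (z - x) < d1 \<Longrightarrow> \<bar>f' z h - f' x h - f'' h (z - x)\<bar> \<le> e' * norm (z - x)"
    by (auto simp: real_norm_def)
  obtain d2 where d2: "d2 > 0" "ball x d2 \<subseteq> S"
    using S open_contains_ball by blast
  define d where "d = min d1 d2 / C"
  have d: "d > 0" using d1 d2 C by (simp add: d_def)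
  have near: "norm (a *\<^sub>R h + b *\<^sub>R k) \<le> t * C"
    if "0 \<le> a" "a \<le> t" "0 \<le> b" "b \<le> t" for a b t
  proof -
    have "norm (a *\<^sub>R h + b *\<^sub>R k) \<le> a * norm h + b * norm k"
      using norm_triangle_ineq[of "a *\<^sub>R h" "b *\<^sub>R k"] that by simp
    also have "\<dots> \<le> t * norm h + t * norm k"
      using that by (intro add_mono mult_right_mono) auto
    also have "\<dots> \<le> t * C"
      using that unfolding C_def by (simp add: algebra_simps mult_nonneg_nonneg)
    finally show ?thesis .
  qed
  have "dist ((f (x + t *\<^sub>R h + t *\<^sub>R k) - f (x + t *\<^sub>R h) - f (x + t *\<^sub>R k) + f x) / t\<^sup>2) (f'' h k) < e"
    if t: "0 < t" "t < d" for t
  proof -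
    have tC: "t * C < min d1 d2"
      using t C by (simp add: d_def field_simps)
    \<comment> \<open>The second difference is \<open>g t - g 0\<close>.\<close>
    define g where "g = (\<lambda>s. f (x + s *\<^sub>R h + t *\<^sub>R k) - f (x + s *\<^sub>R h))"
    have inS: "x + s *\<^sub>R h + t *\<^sub>R k \<in> S" "x + s *\<^sub>R h \<in> S"
      and lt: "norm (s *\<^sub>R h + t *\<^sub>R k) < d1" "norm (s *\<^sub>R h) < d1" if "0 \<le> s" "s \<le> t" for s
    proof -
      have n: "norm (s *\<^sub>R h + t *\<^sub>R k) < min d1 d2" "norm (s *\<^sub>R h) < min d1 d2"
        using near[of s t t] near[of s t 0] that t tC by auto
      then show "norm (s *\<^sub>R h + t *\<^sub>R k) < d1" "norm (s *\<^sub>R h) < d1" by auto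
      have "x + s *\<^sub>R h + t *\<^sub>R k \<in> ball x d2" "x + s *\<^sub>R h \<in> ball x d2"
        using n by (auto simp: dist_norm norm_minus_commute algebra_simps)
      then show "x + s *\<^sub>R h + t *\<^sub>R k \<in> S" "x + s *\<^sub>R h \<in> S" using d2 by auto
    qed
    have deriv: "(g has_derivative (\<lambda>r. r * (f' (x + s *\<^sub>R h + t *\<^sub>R k) h - f' (x + s *\<^sub>R h) h))) (at s)"
      if "0 \<le> s" "s \<le> t" for s
    proof -
      note 1 = f'[OF inS(1)[OF that]] and 2 = f'[OF inS(2)[OF that]]
      have "((\<lambda>s. f (x + s *\<^sub>R h + t *\<^sub>R k)) has_derivative (\<lambda>r. f' (x + s *\<^sub>R h + t *\<^sub>R k) (r *\<^sub>R h))) (at s)"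
        by (rule has_derivative_compose[where f = "\<lambda>s. x + s *\<^sub>R h + t *\<^sub>R k" and g = f, OF _ 1])
          (auto intro!: derivative_eq_intros)
      moreover have "((\<lambda>s. f (x + s *\<^sub>R h)) has_derivative (\<lambda>r. f' (x + s *\<^sub>R h) (r *\<^sub>R h))) (at s)"
        by (rule has_derivative_compose[where f = "\<lambda>s. x + s *\<^sub>R h" and g = f, OF _ 2])
          (auto intro!: derivative_eq_intros)
      ultimately show ?thesis
        unfolding g_def
        using linear_scale[OF has_derivative_linear[OF 1]] linear_scale[OF has_derivative_linear[OF 2]]
        by (auto intro!: derivative_eq_intros simp: algebra_simps)
    qed
    obtain s where s: "0 < s" "s < t"
      "g t - g 0 = (t - 0) * (f' (x + s *\<^sub>R h + t *\<^sub>R k) h - f' (x + s *\<^sub>R h) h)"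
      using mvt_simple[OF t(1), of g "\<lambda>s r. r * (f' (x + s *\<^sub>R h + t *\<^sub>R k) h - f' (x + s *\<^sub>R h) h)"]
        has_derivative_at_withinI[OF deriv] by auto
    have a: "\<bar>f' (x + s *\<^sub>R h + t *\<^sub>R k) h - f' x h - f'' h (s *\<^sub>R h + t *\<^sub>R k)\<bar> \<le> e' * (t * C)"
    proof -
      have "\<bar>f' (x + s *\<^sub>R h + t *\<^sub>R k) h - f' x h - f'' h (s *\<^sub>R h + t *\<^sub>R k)\<bar>
          \<le> e' * norm (s *\<^sub>R h + t *\<^sub>R k)"
        using d1(2)[of "x + s *\<^sub>R h + t *\<^sub>R k"] lt(1)[of s] s by (simp add: add.assoc)
      also have "\<dots> \<le> e' * (t * C)"
        using near[of s t t] s t e' by (intro mult_left_mono) auto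
      finally show ?thesis .
    qed
    have b: "\<bar>f' (x + s *\<^sub>R h) h - f' x h - f'' h (s *\<^sub>R h)\<bar> \<le> e' * (t * C)"
    proof -
      have "\<bar>f' (x + s *\<^sub>R h) h - f' x h - f'' h (s *\<^sub>R h)\<bar> \<le> e' * norm (s *\<^sub>R h)"
        using d1(2)[of "x + s *\<^sub>R h"] lt(2)[of s] s by simp
      also have "\<dots> \<le> e' * (t * C)"
        using near[of s t 0] s t e' by (intro mult_left_mono) auto
      finally show ?thesis .
    qed
    have "f'' h (s *\<^sub>R h + t *\<^sub>R k) - f'' h (s *\<^sub>R h) = t * f'' h k"
      by (simp add: linear_add[OF lin] linear_scale[OF lin])
    then have "\<bar>(f' (x + s *\<^sub>R h + t *\<^sub>R k) h - f' (x + s *\<^sub>R h) h) - t * f'' h k\<bar> \<le> 2 * (e' * (t * C))"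
      using a b by linarith
    moreover have "(f (x + t *\<^sub>R h + t *\<^sub>R k) - f (x + t *\<^sub>R h) - f (x + t *\<^sub>R k) + f x) / t\<^sup>2
        = (f' (x + s *\<^sub>R h + t *\<^sub>R k) h - f' (x + s *\<^sub>R h) h) / t"
    proof -
      have "f (x + t *\<^sub>R h + t *\<^sub>R k) - f (x + t *\<^sub>R h) - f (x + t *\<^sub>R k) + f x
          = t * (f' (x + s *\<^sub>R h + t *\<^sub>R k) h - f' (x + s *\<^sub>R h) h)"
        using s(3) by (simp add: g_def)
      then show ?thesis using t by (simp only: power2_eq_square) simp
    qed
    moreover have "\<bar>A / t - B\<bar> \<le> 2 * (e' * C)" if "\<bar>A - t * B\<bar> \<le> 2 * (e' * (t * C))" for A B
    proof -
      have "A / t - B = (A - t * B) / t" using t by (simp add: field_simps)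
      then have "\<bar>A / t - B\<bar> = \<bar>A - t * B\<bar> / t" using t by simp
      then show ?thesis using that t by (simp add: field_simps)
    qed
    ultimately have "\<bar>(f (x + t *\<^sub>R h + t *\<^sub>R k) - f (x + t *\<^sub>R h) - f (x + t *\<^sub>R k) + f x) / t\<^sup>2 - f'' h k\<bar>
        \<le> 2 * (e' * C)"
      by simp
    moreover have "2 * (e' * C) < e" using C e by (simp add: e'_def)
    ultimately show ?thesis by (simp add: dist_real_def)
  qed
  then show "\<forall>\<^sub>F t in at_right 0. dist ((f (x + t *\<^sub>R h + t *\<^sub>R k) - f (x + t *\<^sub>R h) - f (x + t *\<^sub>R k) + f x) / t\<^sup>2) (f'' h k) < e"
    using d unfolding eventually_at_right_field by blast
qed

text \<open>The second difference is symmetric in \<open>h\<close> and \<open>k\<close>, hence so is its limit.\<close>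

lemma symmetric_second_derivative:
  fixes f :: "'a::real_normed_vector \<Rightarrow> real"
  assumes "open S" "x \<in> S"
    and "\<And>z. z \<in> S \<Longrightarrow> (f has_derivative f' z) (at z)"
    and "\<And>h. ((\<lambda>z. f' z h) has_derivative f'' h) (at x)"
  shows "f'' h k = f'' k h"
proof -
  have swap: "(\<lambda>t. (f (x + t *\<^sub>R k + t *\<^sub>R h) - f (x + t *\<^sub>R k) - f (x + t *\<^sub>R h) + f x) / t\<^sup>2)
      = (\<lambda>t. (f (x + t *\<^sub>R h + t *\<^sub>R k) - f (x + t *\<^sub>R h) - f (x + t *\<^sub>R k) + f x) / t\<^sup>2)"
    by (simp add: algebra_simps)
  note lim = second_difference_tendsto[where f = f and f' = f' and f'' = f'', OF assms]
  show ?thesis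
    using lim[of h k] lim[of k h] unfolding swap
    by (rule tendsto_unique[OF trivial_limit_at_right_real])
qed

section \<open>The geodesic equation as an Euler-Lagrange equation\<close>

text \<open>Agreement near \<open>u\<close> suffices, and is all that is known for the inner function of an iterated
  partial derivative.\<close>

lemma partial_deriv_eqI:
  fixes f g :: "real ^ 'n::finite \<Rightarrow> real"
  assumes ev: "\<forall>\<^sub>F w in nhds u. f w = g w" and g: "(g has_derivative g') (at u)"
  shows "partial_deriv i f u = g' (axis i 1)"
proof -
  have f: "(f has_derivative g') (at u)"
    using ev by (intro has_derivative_transform_eventually[OF g])
      (auto simp: eventually_nhds_conv_at eq_commute)
  have "((\<lambda>t. f (u + t *\<^sub>R axis i 1)) has_derivative (\<lambda>t. g' (t *\<^sub>R axis i 1))) (at 0)"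
    by (rule has_derivative_compose[of "\<lambda>t. u + t *\<^sub>R axis i 1"])
       (auto intro!: derivative_eq_intros f)
  then have "((\<lambda>t. f (u + t *\<^sub>R axis i 1)) has_derivative (\<lambda>t. g' (axis i 1) * t)) (at 0)"
    by (simp add: linear_scale[OF has_derivative_linear[OF g]] mult.commute)
  then show ?thesis
    unfolding partial_deriv_def
    by (intro DERIV_imp_deriv) (simp add: has_field_derivative_def)
qed

lemma linear_axis_expansion:
  fixes f :: "real ^ 'n::finite \<Rightarrow> real"
  assumes "linear f"
  shows "(\<Sum>k\<in>UNIV. f (axis k 1) * y $ k) = f y"
proof -
  have "f y = f (\<Sum>k\<in>UNIV. y $ k *\<^sub>R axis k 1)"
    using basis_expansion[of y] by (simp add: scalar_mult_eq_scaleR)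
  then show ?thesis
    using assms by (simp add: linear_sum linear_scale mult.commute)
qed

text \<open>The fundamental tensor is invertible because it is positive definite, and multiplying
  \<open>a + 2 G = 0\<close> by it gives the Euler-Lagrange equation of \<open>L = F\<^sup>2\<close>. Here \<open>L'\<close> and \<open>L''\<close> are the first and
  second derivatives of \<open>L\<close> jointly in position and velocity, so that \<open>L'' (0, e\<^sub>l) (y, a)\<close> is the
  derivative of \<open>\<partial>L/\<partial>y\<^sup>l\<close> along a curve with velocity \<open>y\<close> and acceleration \<open>a\<close>. The spray coefficients
  take the mixed derivatives in the opposite order, which is where symmetry enters.\<close>

lemma spray_eq_iff_Euler_Lagrange:
  fixes F :: "real ^ 'n::finite \<Rightarrow> real ^ 'n \<Rightarrow> real"
  assumes S: "open S" "(u, y) \<in> S"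
    and L': "\<And>z. z \<in> S \<Longrightarrow> ((\<lambda>z. (F (fst z) (snd z))\<^sup>2) has_derivative L' z) (at z)"
    and L'': "\<And>h. ((\<lambda>z. L' z h) has_derivative L'' h) (at (u, y))"
    and pos: "\<And>k. k \<noteq> 0 \<Longrightarrow> L'' (0, k) (0, k) > 0"
  shows "(\<forall>i. a $ i + 2 * spray_coeff F u y $ i = 0) \<longleftrightarrow>
         (\<forall>l. L'' (0, axis l 1) (y, a) = L' (u, y) (axis l 1, 0))"
proof -
  have sym: "L'' h k = L'' k h" for h k
    by (rule symmetric_second_derivative[OF S L' L''])
  have lin2: "linear (L'' h)" for h
    using L'' has_derivative_linear by blast
  have tend: "((\<lambda>z. (z, y)) \<longlongrightarrow> (u, y)) (nhds u)" "((\<lambda>w. (u, w)) \<longlongrightarrow> (u, y)) (nhds y)"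
    by (auto intro!: tendsto_Pair simp: filterlim_ident)
  have evS: "\<forall>\<^sub>F z in nhds u. (z, y) \<in> S" "\<forall>\<^sub>F w in nhds y. (u, w) \<in> S"
    using tend S by (auto dest: topological_tendstoD)
  have Pair_y: "((\<lambda>w. (u, w)) has_derivative (\<lambda>k. (0, k))) (at w)"
    and Pair_u: "((\<lambda>z. (z, w)) has_derivative (\<lambda>h. (h, 0))) (at u)" for w :: "real ^ 'n"
    by (auto intro!: derivative_eq_intros)
  have in_y: "partial_deriv i (\<lambda>w. (F u w)\<^sup>2) w = L' (u, w) (0, axis i 1)" if "(u, w) \<in> S" for w i
  proof -
    have "((\<lambda>w. (F u w)\<^sup>2) has_derivative (\<lambda>k. L' (u, w) (0, k))) (at w)"
      using has_derivative_compose[OF Pair_y L'[OF that]] by simp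
    then show ?thesis
      using partial_deriv_eqI[of "\<lambda>w. (F u w)\<^sup>2" "\<lambda>w. (F u w)\<^sup>2"] by auto
  qed
  have in_u: "partial_deriv i (\<lambda>z. (F z w)\<^sup>2) u = L' (u, w) (axis i 1, 0)" if "(u, w) \<in> S" for w i
  proof -
    have "((\<lambda>z. (F z w)\<^sup>2) has_derivative (\<lambda>h. L' (u, w) (h, 0))) (at u)"
      using has_derivative_compose[OF Pair_u L'[OF that]] by simp
    then show ?thesis
      using partial_deriv_eqI[of "\<lambda>z. (F z w)\<^sup>2" "\<lambda>z. (F z w)\<^sup>2"] by auto
  qed
  have L'y: "((\<lambda>w. L' (u, w) h) has_derivative (\<lambda>k. L'' h (0, k))) (at y)" for h
    using has_derivative_compose[OF Pair_y L''] by simp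
  have g: "fundamental_tensor F u y $ i $ j = 1 / 2 * L'' (0, axis i 1) (0, axis j 1)" for i j
    using partial_deriv_eqI[OF eventually_mono[OF evS(2) in_y] L'y]
    by (simp add: fundamental_tensor_def)
  have mixed: "partial_deriv l (\<lambda>w. partial_deriv k (\<lambda>z. (F z w)\<^sup>2) u) y = L'' (axis k 1, 0) (0, axis l 1)"
    for k l
    using partial_deriv_eqI[OF eventually_mono[OF evS(2) in_u] L'y] by simp
  have lin_u: "linear (\<lambda>h. L'' k (h, 0))" and lin_y: "linear (\<lambda>h. L'' k (0, h))" for k
    using linear_compose[OF _ lin2, of "\<lambda>h. (h, 0)"] linear_compose[OF _ lin2, of "\<lambda>h. (0, h)"]
    by (auto simp: o_def linear_iff)
  have mixed_sum: "(\<Sum>k\<in>UNIV. partial_deriv l (\<lambda>w. partial_deriv k (\<lambda>z. (F z w)\<^sup>2) u) y * y $ k)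
      = L'' (0, axis l 1) (y, 0)" for l
    unfolding mixed sym[of "(axis _ 1, 0)"] using linear_axis_expansion[OF lin_u] by simp
  define G where "G = fundamental_tensor F u y"
  have Gv: "(G *v k) $ i = 1 / 2 * L'' (0, axis i 1) (0, k)" for k i
    unfolding G_def matrix_vector_mult_def g
    using linear_axis_expansion[OF lin_y, of "(0, axis i 1)" k]
    by (simp add: sum_divide_distrib[symmetric])
  have inv: "invertible G"
  proof -
    have "k = 0" if "G *v k = 0" for k
    proof (rule ccontr)
      assume "k \<noteq> 0"
      have "L'' (0, axis i 1) (0, k) = 0" for i
        using Gv[of k i] that by simp
      then have "(\<Sum>i\<in>UNIV. L'' (0, k) (0, axis i 1) * k $ i) = 0"
        by (simp add: sym[of "(0, k)"])
      then show False
        using linear_axis_expansion[OF lin_y] pos[OF \<open>k \<noteq> 0\<close>] by simp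
    qed
    then show ?thesis
      by (simp add: invertible_left_inverse matrix_left_invertible_ker)
  qed
  have G_inv: "G ** matrix_inv G = mat 1" "matrix_inv G ** G = mat 1"
    using someI_ex[OF inv[unfolded invertible_def]] unfolding matrix_inv_def by auto
  define R where "R = (\<chi> l. L'' (0, axis l 1) (y, 0) - L' (u, y) (axis l 1, 0))"
  have spray: "2 *\<^sub>R spray_coeff F u y = (1/2) *\<^sub>R (matrix_inv G *v R)"
    unfolding spray_coeff_def mixed_sum in_u[OF S(2)] matrix_vector_mult_def R_def G_def
    by (simp add: vec_eq_iff sum_distrib_left sum_divide_distrib)
  have "(\<forall>i. a $ i + 2 * spray_coeff F u y $ i = 0) \<longleftrightarrow> a + 2 *\<^sub>R spray_coeff F u y = 0"
    by (simp add: vec_eq_iff)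
  also have "\<dots> \<longleftrightarrow> 2 *\<^sub>R a + matrix_inv G *v R = 0"
    unfolding spray by (auto simp: vec_eq_iff field_simps)
  also have "\<dots> \<longleftrightarrow> G *v (2 *\<^sub>R a) + R = 0"
  proof
    assume "2 *\<^sub>R a + matrix_inv G *v R = 0"
    then have "G *v (2 *\<^sub>R a + matrix_inv G *v R) = 0" by simp
    then show "G *v (2 *\<^sub>R a) + R = 0"
      using G_inv(1)
      by (simp only: matrix_vector_right_distrib matrix_vector_mul_assoc matrix_vector_mul_lid)
  next
    assume "G *v (2 *\<^sub>R a) + R = 0"
    then have "matrix_inv G *v (G *v (2 *\<^sub>R a) + R) = 0" by simp
    then show "2 *\<^sub>R a + matrix_inv G *v R = 0"
      using G_inv(2)
      by (simp only: matrix_vector_right_distrib matrix_vector_mul_assoc matrix_vector_mul_lid)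
  qed
  also have "\<dots> \<longleftrightarrow> (\<forall>l. L'' (0, axis l 1) (0, a) + R $ l = 0)"
    by (simp add: vec_eq_iff Gv matrix_vector_mult_scaleR)
  also have "\<dots> \<longleftrightarrow> (\<forall>l. L'' (0, axis l 1) (y, a) = L' (u, y) (axis l 1, 0))"
  proof -
    have "L'' h (y, a) = L'' h (y, 0) + L'' h (0, a)" for h
      using linear_add[OF lin2, of h "(y, 0)" "(0, a)"] by simp
    then show ?thesis by (simp add: R_def algebra_simps)
  qed
  finally show ?thesis .
qed

section \<open>The norm with a given wind\<close>

text \<open>The positive root \<open>f\<close> of \<open>(1 - w \<bullet> w) f\<^sup>2 + 2 (y \<bullet> w) f - y \<bullet> y = 0\<close>, the square of the navigation
  equation \<open>\<bar>y - f w\<bar> = f\<close>.\<close>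

definition nav_norm :: "'a::real_inner \<Rightarrow> 'a \<Rightarrow> real" where
  "nav_norm w y = (sqrt ((y \<bullet> w)\<^sup>2 + (1 - w \<bullet> w) * (y \<bullet> y)) - y \<bullet> w) / (1 - w \<bullet> w)"

definition relative_velocity :: "'a::real_inner \<Rightarrow> 'a \<Rightarrow> 'a" where
  "relative_velocity w y = y - nav_norm w y *\<^sub>R w"

text \<open>Half the gradient of \<open>(nav_norm w y)\<^sup>2\<close> in \<open>y\<close>, the Legendre transform of \<open>y\<close>.\<close>

definition nav_momentum :: "'a::real_inner \<Rightarrow> 'a \<Rightarrow> 'a" where
  "nav_momentum w y =
     (nav_norm w y / (nav_norm w y + relative_velocity w y \<bullet> w)) *\<^sub>R relative_velocity w y"

definition nav_domain :: "('a::real_inner \<times> 'a) set" where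
  "nav_domain = {z. norm (fst z) < 1 \<and> snd z \<noteq> 0}"

lemma open_nav_domain: "open nav_domain"
  unfolding nav_domain_def
  by (intro open_Collect_conj open_Collect_less open_Collect_neq continuous_intros)

lemma nav_discriminant_pos:
  fixes w y :: "'a::real_inner"
  assumes "norm w < 1" "y \<noteq> 0"
  shows "1 - w \<bullet> w > 0" "(y \<bullet> w)\<^sup>2 + (1 - w \<bullet> w) * (y \<bullet> y) > 0"
proof -
  show 1: "1 - w \<bullet> w > 0"
    using assms(1) by (simp add: dot_square_norm power_less_one_iff abs_square_less_1)
  then show "(y \<bullet> w)\<^sup>2 + (1 - w \<bullet> w) * (y \<bullet> y) > 0"
    using assms(2) by (intro add_nonneg_pos mult_pos_pos) auto
qed

lemma nav_norm_solves:
  fixes w y :: "'a::real_inner"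
  assumes "norm w < 1" "y \<noteq> 0"
  shows "nav_norm w y > 0" "norm (relative_velocity w y) = nav_norm w y"
proof -
  define l where "l = 1 - w \<bullet> w"
  define s where "s = sqrt ((y \<bullet> w)\<^sup>2 + l * (y \<bullet> y))"
  note pos = nav_discriminant_pos[OF assms, folded l_def]
  have s2: "s\<^sup>2 = (y \<bullet> w)\<^sup>2 + l * (y \<bullet> y)" using pos by (simp add: s_def)
  have N: "nav_norm w y = (s - y \<bullet> w) / l" by (simp add: nav_norm_def s_def l_def)
  have "sqrt ((y \<bullet> w)\<^sup>2) < s"
    unfolding s_def using pos assms by (intro real_sqrt_less_mono) simp
  then have "\<bar>y \<bullet> w\<bar> < s" by simp
  then show gt: "nav_norm w y > 0" using pos by (simp add: N)
  have "l * (nav_norm w y)\<^sup>2 + 2 * nav_norm w y * (y \<bullet> w) - y \<bullet> y = (s\<^sup>2 - (y \<bullet> w)\<^sup>2 - l * (y \<bullet> y)) / l"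
    unfolding N using pos by (simp add: field_simps power2_eq_square)
  also have "\<dots> = 0" by (simp add: s2)
  finally have "(norm (relative_velocity w y))\<^sup>2 = (nav_norm w y)\<^sup>2"
    unfolding power2_norm_eq_inner relative_velocity_def l_def
    by (simp add: inner_diff inner_commute algebra_simps power2_eq_square)
  then show "norm (relative_velocity w y) = nav_norm w y"
    using gt by (simp add: power2_eq_iff_nonneg)
qed

lemma navigation_metric_eq_nav_norm:
  assumes "norm (V x) < 1" "y \<noteq> 0"
  shows "navigation_metric V x y = nav_norm (V x) y"
  unfolding navigation_metric_def
  using assms nav_norm_solves[OF assms] navigation_metric_ex1[OF assms]
  by (auto simp: relative_velocity_def intro!: the1_equality)

text \<open>The relative velocity \<open>W\<close> has norm \<open>nav_norm w y\<close>, so \<open>\<bar>W \<bullet> w\<bar> \<le> \<bar>W\<bar> \<bar>w\<bar> < nav_norm w y\<close>.\<close>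

lemma nav_denominator_pos:
  assumes "norm w < 1" "y \<noteq> 0"
  shows "nav_norm w y + relative_velocity w y \<bullet> w > 0"
proof -
  have "\<bar>relative_velocity w y \<bullet> w\<bar> \<le> nav_norm w y * norm w"
    using Cauchy_Schwarz_ineq2[of "relative_velocity w y" w] nav_norm_solves(2)[OF assms] by simp
  also have "\<dots> < nav_norm w y * 1"
    using assms nav_norm_solves(1)[OF assms] by (intro mult_strict_left_mono) auto
  finally show ?thesis by linarith
qed

lemma differentiable_nav_norm:
  fixes w y :: "'a::real_inner"
  assumes "norm w < 1" "y \<noteq> 0"
  shows "(\<lambda>z. nav_norm (fst z) (snd z)) differentiable (at (w, y))"
proof -
  note pos = nav_discriminant_pos[OF assms]
  have fst: "fst differentiable (at (w, y))" and snd: "snd differentiable (at (w, y))"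
    by (simp_all add: bounded_linear_fst bounded_linear_snd bounded_linear_imp_differentiable)
  have "(\<lambda>z. (snd z \<bullet> fst z)\<^sup>2 + (1 - fst z \<bullet> fst z) * (snd z \<bullet> snd z)) differentiable (at (w, y))"
    by (intro differentiable_add differentiable_diff differentiable_mult differentiable_power
        differentiable_inner differentiable_const fst snd)
  then obtain d where d: "((\<lambda>z. (snd z \<bullet> fst z)\<^sup>2 + (1 - fst z \<bullet> fst z) * (snd z \<bullet> snd z))
      has_derivative d) (at (w, y))"
    unfolding differentiable_def by blast
  have sqrt: "(\<lambda>z. sqrt ((snd z \<bullet> fst z)\<^sup>2 + (1 - fst z \<bullet> fst z) * (snd z \<bullet> snd z)))
      differentiable (at (w, y))"
    using has_derivative_real_sqrt[OF _ d] pos(2) unfolding differentiable_def by auto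
  show ?thesis
    unfolding nav_norm_def using pos(1)
    by (intro differentiable_divide differentiable_diff sqrt differentiable_inner
        differentiable_const fst snd) auto
qed

lemma has_derivative_relative_velocity:
  fixes w y :: "'a::real_inner"
  assumes "((\<lambda>z. nav_norm (fst z) (snd z)) has_derivative N') (at (w, y))"
  shows "((\<lambda>z. relative_velocity (fst z) (snd z)) has_derivative
    (\<lambda>h. snd h - N' h *\<^sub>R w - nav_norm w y *\<^sub>R fst h)) (at (w, y))"
  unfolding relative_velocity_def
  by (rule assms derivative_eq_intros refl)+ (simp add: algebra_simps)

text \<open>Once the norm is known to be differentiable, its derivative \<open>N'\<close> is read off from the identity
  \<open>\<bar>W\<bar>\<^sup>2 = N\<^sup>2\<close>, which keeps the square root out of all later formulas.\<close>

lemma has_derivative_nav_norm: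
  fixes w y :: "'a::real_inner"
  assumes "norm w < 1" "y \<noteq> 0"
  shows "((\<lambda>z. nav_norm (fst z) (snd z)) has_derivative
    (\<lambda>h. relative_velocity w y \<bullet> (snd h - nav_norm w y *\<^sub>R fst h) /
          (nav_norm w y + relative_velocity w y \<bullet> w))) (at (w, y))"
proof -
  let ?W = "relative_velocity w y" and ?N = "nav_norm w y"
  obtain N' where N': "((\<lambda>z. nav_norm (fst z) (snd z)) has_derivative N') (at (w, y))"
    using differentiable_nav_norm[OF assms] unfolding differentiable_def by blast
  have 1: "((\<lambda>z. relative_velocity (fst z) (snd z) \<bullet> relative_velocity (fst z) (snd z)
      - (nav_norm (fst z) (snd z))\<^sup>2) has_derivative
      (\<lambda>h. 2 * (?W \<bullet> (snd h - N' h *\<^sub>R w - ?N *\<^sub>R fst h)) - 2 * ?N * N' h)) (at (w, y))"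
    by (rule N' has_derivative_relative_velocity[OF N'] derivative_eq_intros refl)+
       (simp add: inner_commute algebra_simps)
  have "((\<lambda>z. 0) has_derivative
      (\<lambda>h. 2 * (?W \<bullet> (snd h - N' h *\<^sub>R w - ?N *\<^sub>R fst h)) - 2 * ?N * N' h)) (at (w, y))"
  proof (rule has_derivative_transform_within_open[OF 1 open_nav_domain])
    show "(w, y) \<in> nav_domain" using assms by (simp add: nav_domain_def)
    show "relative_velocity (fst z) (snd z) \<bullet> relative_velocity (fst z) (snd z)
      - (nav_norm (fst z) (snd z))\<^sup>2 = 0" if "z \<in> nav_domain" for z
      using that nav_norm_solves(2)[of "fst z" "snd z"]
      by (simp add: nav_domain_def dot_square_norm)
  qed
  from fun_cong[OF has_derivative_unique[OF this has_derivative_const]]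
  have zero: "2 * (?W \<bullet> (snd h - N' h *\<^sub>R w - ?N *\<^sub>R fst h)) - 2 * ?N * N' h = 0" for h .
  have "N' h * (?N + ?W \<bullet> w) = ?W \<bullet> (snd h - ?N *\<^sub>R fst h)" for h
    using zero[of h] by (simp add: inner_diff_right algebra_simps)
  then have "N' = (\<lambda>h. ?W \<bullet> (snd h - ?N *\<^sub>R fst h) / (?N + ?W \<bullet> w))"
    using nav_denominator_pos[OF assms] by (simp add: fun_eq_iff nonzero_eq_divide_eq)
  then show ?thesis using N' by simp
qed

text \<open>A change \<open>\<omega>\<close> of the wind acts like the change \<open>- N \<omega>\<close> of the velocity, so the momentum carries
  both partial derivatives.\<close>

lemma has_derivative_nav_norm_squared:
  fixes w y :: "'a::real_inner"
  assumes "norm w < 1" "y \<noteq> 0"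
  shows "((\<lambda>z. (nav_norm (fst z) (snd z))\<^sup>2) has_derivative
    (\<lambda>h. 2 * (nav_momentum w y \<bullet> (snd h - nav_norm w y *\<^sub>R fst h)))) (at (w, y))"
  unfolding nav_momentum_def
  by (rule has_derivative_nav_norm[OF assms] derivative_eq_intros refl)+ (simp add: ac_simps)

lemma differentiable_nav_momentum:
  fixes w y :: "'a::real_inner"
  assumes "norm w < 1" "y \<noteq> 0"
  shows "(\<lambda>z. nav_momentum (fst z) (snd z)) differentiable (at (w, y))"
proof -
  have W: "(\<lambda>z. relative_velocity (fst z) (snd z)) differentiable (at (w, y))"
    using has_derivative_relative_velocity[OF has_derivative_nav_norm[OF assms]]
    unfolding differentiable_def by blast
  have fst: "(\<lambda>z. fst z) differentiable (at (w, y))"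
    by (simp add: bounded_linear_fst bounded_linear_imp_differentiable)
  show ?thesis
    unfolding nav_momentum_def
    using nav_denominator_pos[OF assms]
    by (intro differentiable_scaleR differentiable_divide differentiable_add differentiable_inner
        differentiable_nav_norm assms W fst) auto
qed

text \<open>The fundamental tensor is positive definite. With \<open>D = N + W \<bullet> w\<close>, the derivative \<open>t\<close> of the norm in
  direction \<open>k\<close> and \<open>p = k - t w\<close>, the quadratic form at \<open>k\<close> is \<open>t\<^sup>2 + N (\<bar>p\<bar>\<^sup>2 - t\<^sup>2) / D\<close>. Moreover
  \<open>W \<bullet> p = t N\<close> and \<open>\<bar>W\<bar> = N\<close>, so that \<open>\<bar>t\<bar> \<le> \<bar>p\<bar>\<close>; and if \<open>t = 0\<close> then \<open>p = k \<noteq> 0\<close>.\<close>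

lemma nav_momentum_derivative_pos:
  fixes w y :: "'a::real_inner"
  assumes dom: "norm w < 1" "y \<noteq> 0"
    and M': "((\<lambda>z. nav_momentum (fst z) (snd z)) has_derivative M') (at (w, y))"
    and "k \<noteq> 0"
  shows "M' (0, k) \<bullet> k > 0"
proof -
  define W N D where "W = relative_velocity w y" and "N = nav_norm w y" and "D = N + W \<bullet> w"
  define t p where "t = W \<bullet> k / D" and "p = k - t *\<^sub>R w"
  have D: "D > 0" and N: "N > 0" and W: "norm W = N"
    using nav_denominator_pos[OF dom] nav_norm_solves[OF dom] by (auto simp: D_def W_def N_def)
  note N' = has_derivative_nav_norm[OF dom, folded W_def N_def, folded D_def]
  note W' = has_derivative_relative_velocity[OF N', folded N_def]
  \<comment> \<open>Differentiating \<open>D (M \<bullet> k) = N (W \<bullet> k)\<close> avoids the quotient in the momentum.\<close>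
  have l: "((\<lambda>z. (nav_norm (fst z) (snd z) + relative_velocity (fst z) (snd z) \<bullet> fst z)
        * (nav_momentum (fst z) (snd z) \<bullet> k)) has_derivative
      (\<lambda>h. (W \<bullet> (snd h - N *\<^sub>R fst h) / D
         + ((snd h - (W \<bullet> (snd h - N *\<^sub>R fst h) / D) *\<^sub>R w - N *\<^sub>R fst h) \<bullet> w + W \<bullet> fst h))
         * (nav_momentum w y \<bullet> k) + D * (M' h \<bullet> k))) (at (w, y))"
    by (rule N' W' M' derivative_eq_intros refl)+ (simp add: W_def N_def D_def ac_simps)
  have r: "((\<lambda>z. nav_norm (fst z) (snd z) * (relative_velocity (fst z) (snd z) \<bullet> k)) has_derivative
      (\<lambda>h. (W \<bullet> (snd h - N *\<^sub>R fst h) / D) * (W \<bullet> k)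
         + N * ((snd h - (W \<bullet> (snd h - N *\<^sub>R fst h) / D) *\<^sub>R w - N *\<^sub>R fst h) \<bullet> k))) (at (w, y))"
    by (rule N' W' derivative_eq_intros refl)+ (simp add: W_def N_def D_def ac_simps)
  have "((\<lambda>z. nav_norm (fst z) (snd z) * (relative_velocity (fst z) (snd z) \<bullet> k)) has_derivative
      (\<lambda>h. (W \<bullet> (snd h - N *\<^sub>R fst h) / D
         + ((snd h - (W \<bullet> (snd h - N *\<^sub>R fst h) / D) *\<^sub>R w - N *\<^sub>R fst h) \<bullet> w + W \<bullet> fst h))
         * (nav_momentum w y \<bullet> k) + D * (M' h \<bullet> k))) (at (w, y))"
  proof (rule has_derivative_transform_within_open[OF l open_nav_domain])
    show "(w, y) \<in> nav_domain" using dom by (simp add: nav_domain_def)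
    show "(nav_norm (fst z) (snd z) + relative_velocity (fst z) (snd z) \<bullet> fst z)
        * (nav_momentum (fst z) (snd z) \<bullet> k)
        = nav_norm (fst z) (snd z) * (relative_velocity (fst z) (snd z) \<bullet> k)" if "z \<in> nav_domain" for z
      using that nav_denominator_pos[of "fst z" "snd z"]
      by (simp add: nav_domain_def nav_momentum_def)
  qed
  from fun_cong[OF has_derivative_unique[OF this r], of "(0, k)"]
  have eq: "(t + p \<bullet> w) * (nav_momentum w y \<bullet> k) + D * (M' (0, k) \<bullet> k) = t * (W \<bullet> k) + N * (p \<bullet> k)"
    by (simp add: t_def p_def)
  have Wk: "W \<bullet> k = t * D" using D by (simp add: t_def)
  have Mk: "nav_momentum w y \<bullet> k = N * t"
    by (simp add: nav_momentum_def t_def W_def N_def D_def)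
  have "p \<bullet> k = p \<bullet> p + t * (p \<bullet> w)" by (simp add: p_def inner_diff inner_commute algebra_simps)
  then have M'k: "D * (M' (0, k) \<bullet> k) = t\<^sup>2 * D + N * ((norm p)\<^sup>2 - t\<^sup>2)"
    using eq unfolding Wk Mk power2_norm_eq_inner by (simp add: power2_eq_square algebra_simps)
  have "W \<bullet> p = t * N" using Wk by (simp add: p_def inner_diff_right D_def algebra_simps)
  then have "\<bar>t\<bar> * N \<le> norm p * N"
    using Cauchy_Schwarz_ineq2[of W p] N W by (simp add: abs_mult mult.commute)
  then have tp: "t\<^sup>2 \<le> (norm p)\<^sup>2"
    using N by (simp add: abs_le_square_iff[symmetric])
  have "D * (M' (0, k) \<bullet> k) > 0"
  proof (cases "t = 0")
    case True
    then show ?thesis using M'k N \<open>k \<noteq> 0\<close> by (simp add: p_def)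
  next
    case False
    then show ?thesis using M'k N D tp by (simp add: add_pos_nonneg)
  qed
  then show ?thesis using D by (simp add: zero_less_mult_iff)
qed

section \<open>Directional derivatives of smooth maps\<close>

abbreviation dir_deriv :: "('a::euclidean_space \<Rightarrow> 'b::euclidean_space) \<Rightarrow> 'a \<Rightarrow> 'a \<Rightarrow> 'b" where
  "dir_deriv f v u \<equiv> frechet_derivative f (at u) v"

lemma smooth_on_dir_deriv: "smooth_on U f \<Longrightarrow> smooth_on U (dir_deriv f v)"
  unfolding smooth_on_def using Ck_on.simps(2) by blast

lemma smooth_on_has_derivative:
  assumes "smooth_on U f" "u \<in> U"
  shows "(f has_derivative (\<lambda>h. dir_deriv f h u)) (at u)"
proof -
  have "Ck_on (Suc 0) U f" using assms unfolding smooth_on_def by blast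
  then show ?thesis
    using assms(2) by (auto simp: frechet_derivative_works)
qed

lemma linear_dir_deriv:
  assumes "smooth_on U f" "u \<in> U"
  shows "linear (\<lambda>h. dir_deriv f h u)"
  using smooth_on_has_derivative[OF assms] has_derivative_linear by blast

lemma dir_deriv_commute:
  fixes f :: "'a::euclidean_space \<Rightarrow> 'b::euclidean_space"
  assumes "open U" "smooth_on U f" "u \<in> U"
  shows "dir_deriv (dir_deriv f h) k u = dir_deriv (dir_deriv f k) h u"
proof -
  have "dir_deriv (dir_deriv f h) k u \<bullet> e = dir_deriv (dir_deriv f k) h u \<bullet> e" for e
  proof (rule symmetric_second_derivative[where f = "\<lambda>z. f z \<bullet> e" and S = U and x = u
        and f' = "\<lambda>z h. dir_deriv f h z \<bullet> e"])
    show "((\<lambda>z. f z \<bullet> e) has_derivative (\<lambda>h. dir_deriv f h z \<bullet> e)) (at z)" if "z \<in> U" for z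
      by (intro has_derivative_inner_left smooth_on_has_derivative[OF assms(2) that])
    show "((\<lambda>z. dir_deriv f h z \<bullet> e) has_derivative (\<lambda>k. dir_deriv (dir_deriv f h) k u \<bullet> e)) (at u)" for h
      by (intro has_derivative_inner_left
          smooth_on_has_derivative[OF smooth_on_dir_deriv[OF assms(2)] assms(3)])
  qed (use assms in auto)
  then show ?thesis using vector_eq_rdot by blast
qed

text \<open>The direction \<open>v\<close> of the inner derivative becomes that of the outer one by symmetry, where
  linearity is immediate.\<close>

lemma linear_dir_deriv2:
  assumes "open U" "smooth_on U f" "u \<in> U"
  shows "linear (\<lambda>v. dir_deriv (dir_deriv f v) h u)"
  unfolding dir_deriv_commute[OF assms, of _ h]
  by (rule linear_dir_deriv[OF smooth_on_dir_deriv[OF assms(2)] assms(3)])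

text \<open>Expanding the direction in the basis leaves finitely many directional derivatives, each a
  differentiable function of the point alone.\<close>

lemma has_derivative_dir_deriv_joint:
  fixes f :: "'a::euclidean_space \<Rightarrow> 'b::euclidean_space"
  assumes "open U" "smooth_on U f" "u \<in> U"
  shows "((\<lambda>z. dir_deriv f (snd z) (fst z)) has_derivative
    (\<lambda>h. dir_deriv (dir_deriv f y) (fst h) u + dir_deriv f (snd h) u)) (at (u, y))"
proof -
  have expand: "g y = (\<Sum>b\<in>Basis. (y \<bullet> b) *\<^sub>R g b)" if "linear g" for g :: "'a \<Rightarrow> 'b" and y
    by (subst euclidean_representation[of y, symmetric])
       (simp only: linear_sum[OF that] linear_scale[OF that])
  have d: "((\<lambda>z. dir_deriv f b (fst z)) has_derivative (\<lambda>h. dir_deriv (dir_deriv f b) (fst h) u)) (at (u, y))" for b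
    using has_derivative_compose[OF has_derivative_fst[OF has_derivative_ident], of "dir_deriv f b" "\<lambda>h. dir_deriv (dir_deriv f b) h u" "(u,y)" UNIV]
      smooth_on_has_derivative[OF smooth_on_dir_deriv[OF assms(2)] assms(3), of b] by simp
  have "((\<lambda>z. \<Sum>b\<in>Basis. (snd z \<bullet> b) *\<^sub>R dir_deriv f b (fst z)) has_derivative
    (\<lambda>h. \<Sum>b\<in>Basis. (y \<bullet> b) *\<^sub>R dir_deriv (dir_deriv f b) (fst h) u + (snd h \<bullet> b) *\<^sub>R dir_deriv f b u))
    (at (u, y))"
    by (rule has_derivative_eq_rhs, (rule has_derivative_sum has_derivative_scaleR d
        has_derivative_inner_left has_derivative_snd has_derivative_ident)+) simp
  then have "((\<lambda>z. \<Sum>b\<in>Basis. (snd z \<bullet> b) *\<^sub>R dir_deriv f b (fst z)) has_derivative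
    (\<lambda>h. dir_deriv (dir_deriv f y) (fst h) u + dir_deriv f (snd h) u)) (at (u, y))"
    by (simp only: sum.distrib expand[OF linear_dir_deriv2[OF assms], symmetric]
        expand[OF linear_dir_deriv[OF assms(2,3)], symmetric])
  then show ?thesis
  proof (rule has_derivative_transform_within_open)
    show "open (U \<times> (UNIV :: 'a set))" using assms by (simp add: open_Times)
    show "(u, y) \<in> U \<times> UNIV" using assms by simp
    show "(\<Sum>b\<in>Basis. (snd z \<bullet> b) *\<^sub>R dir_deriv f b (fst z)) = dir_deriv f (snd z) (fst z)"
      if "z \<in> U \<times> UNIV" for z
      using that by (intro expand[symmetric] linear_dir_deriv[OF assms(2)]) auto
  qed
qed

text \<open>Exchanging the two directions reduces this to the preceding lemma for the smooth map
  \<open>dir_deriv f h\<close>.\<close>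

lemma differentiable_dir_deriv2_joint:
  fixes f :: "'a::euclidean_space \<Rightarrow> 'b::euclidean_space"
  assumes "open U" "smooth_on U f" "u \<in> U"
  shows "(\<lambda>z. dir_deriv (dir_deriv f (snd z)) h (fst z)) differentiable (at (u, y))"
proof -
  note has_derivative_dir_deriv_joint[OF assms(1) smooth_on_dir_deriv[OF assms(2)] assms(3), of h y]
  then have "((\<lambda>z. dir_deriv (dir_deriv f (snd z)) h (fst z)) has_derivative
    (\<lambda>k. dir_deriv (dir_deriv (dir_deriv f h) y) (fst k) u + dir_deriv (dir_deriv f h) (snd k) u)) (at (u, y))"
  proof (rule has_derivative_transform_within_open)
    show "open (U \<times> (UNIV :: 'a set))" using assms by (simp add: open_Times)
    show "(u, y) \<in> U \<times> UNIV" using assms by simp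
    show "dir_deriv (dir_deriv f h) (snd z) (fst z) = dir_deriv (dir_deriv f (snd z)) h (fst z)"
      if "z \<in> U \<times> UNIV" for z
      using that by (intro dir_deriv_commute[OF assms(1,2)]) auto
  qed
  then show ?thesis unfolding differentiable_def by blast
qed

section \<open>The Euler-Lagrange equation of a navigation metric\<close>

lemma has_real_derivative_iff_eq:
  fixes f :: "real \<Rightarrow> real"
  assumes "(f has_real_derivative p) (at s)"
  shows "(f has_real_derivative q) (at s) \<longleftrightarrow> p = q"
  using assms DERIV_unique by blast

text \<open>In a chart \<open>F\<^sup>2\<close> is the squared norm of \<open>nav_norm\<close> after the map \<open>B\<close> that sends position and velocity
  coordinates to the wind and the velocity in the ambient space. Its velocity derivative in
  direction \<open>k\<close> is twice the pairing of the momentum with \<open>d\<phi> k\<close>, so positivity of the fundamental tensor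
  is inherited because \<open>d\<phi>\<close> is injective.\<close>

lemma navigation_spray_iff:
  fixes \<phi> :: "real ^ 'n::finite \<Rightarrow> real ^ 'm::finite" and V :: "real ^ 'm \<Rightarrow> real ^ 'm"
  defines "M \<equiv> (\<lambda>z. nav_momentum (V (\<phi> (fst z))) (dir_deriv \<phi> (snd z) (fst z)))"
  assumes U: "open U" "smooth_on U \<phi>" and inj: "\<And>u. u \<in> U \<Longrightarrow> inj (\<lambda>h. dir_deriv \<phi> h u)"
    and V: "linear V" "\<And>u. u \<in> U \<Longrightarrow> norm (V (\<phi> u)) < 1"
    and u: "c s \<in> U" and y: "v s \<noteq> 0"
    and c: "(c has_vector_derivative v s) (at s)" and v: "(v has_vector_derivative a) (at s)"
  shows "(\<forall>i. a $ i + 2 * spray_coeff (chart_metric (navigation_metric V) \<phi>) (c s) (v s) $ i = 0) \<longleftrightarrow>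
    (\<forall>l. ((\<lambda>t. M (c t, v t) \<bullet> dir_deriv \<phi> (axis l 1) (c t)) has_real_derivative
        M (c s, v s) \<bullet> (dir_deriv (dir_deriv \<phi> (v s)) (axis l 1) (c s)
        - nav_norm (V (\<phi> (c s))) (dir_deriv \<phi> (v s) (c s)) *\<^sub>R V (dir_deriv \<phi> (axis l 1) (c s)))) (at s))"
proof -
  define u y where "u = c s" and "y = v s"
  note u = u[folded u_def] and y = y[folded y_def]
  define F where "F = chart_metric (navigation_metric V) \<phi>"
  define S where "S = {z. fst z \<in> U \<and> snd z \<noteq> (0 :: real ^ 'n)}"
  define B where "B = (\<lambda>z. (V (\<phi> (fst z)), dir_deriv \<phi> (snd z) (fst z)))"
  define B' where "B' = (\<lambda>z h. (V (dir_deriv \<phi> (fst h) (fst z)),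
    dir_deriv (dir_deriv \<phi> (snd z)) (fst h) (fst z) + dir_deriv \<phi> (snd h) (fst z)))"
  define N where "N = (\<lambda>z. nav_norm (fst (B z)) (snd (B z)))"
  define L' where "L' = (\<lambda>z h. 2 * (M z \<bullet> (snd (B' z h) - N z *\<^sub>R fst (B' z h))))"
  have S_eq: "S = U \<times> (- {0})" by (auto simp: S_def)
  have S: "open S" "(u, y) \<in> S"
    unfolding S_eq using u y U(1) by (auto intro!: open_Times)
  have lin: "linear (\<lambda>h. dir_deriv \<phi> h v)" if "v \<in> U" for v
    by (rule linear_dir_deriv[OF U(2) that])
  have nz: "dir_deriv \<phi> k v \<noteq> 0" if "v \<in> U" "k \<noteq> 0" for v k
    using inj[OF that(1)] that(2) linear_injective_0[OF lin[OF that(1)]] by blast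
  have dom: "norm (fst (B z)) < 1" "snd (B z) \<noteq> 0" if "z \<in> S" for z
    using that V(2) nz by (auto simp: B_def S_def)
  have blV: "bounded_linear V" using V(1) by (simp add: linear_conv_bounded_linear)
  have fst: "(fst has_derivative fst) (at z)" for z :: "(real ^ 'n) \<times> (real ^ 'n)"
    by (rule bounded_linear_imp_has_derivative[OF bounded_linear_fst])
  have B: "(B has_derivative B' z) (at z)" if "z \<in> S" for z
  proof -
    have "fst z \<in> U" using that by (simp add: S_def)
    have 1: "((\<lambda>z. \<phi> (fst z)) has_derivative (\<lambda>h. dir_deriv \<phi> (fst h) (fst z))) (at z)"
      by (rule has_derivative_compose[OF fst smooth_on_has_derivative[OF U(2) \<open>fst z \<in> U\<close>]])
    have 2: "((\<lambda>z. V (\<phi> (fst z))) has_derivative (\<lambda>h. V (dir_deriv \<phi> (fst h) (fst z)))) (at z)"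
      by (rule bounded_linear.has_derivative[OF blV 1])
    show ?thesis
      unfolding B_def B'_def
      using has_derivative_Pair[OF 2 has_derivative_dir_deriv_joint[OF U \<open>fst z \<in> U\<close>, of "snd z", unfolded prod.collapse]]
      by simp
  qed
  have L': "((\<lambda>z. (F (fst z) (snd z))\<^sup>2) has_derivative L' z) (at z)" if "z \<in> S" for z
  proof -
    have "((\<lambda>z. (nav_norm (fst (B z)) (snd (B z)))\<^sup>2) has_derivative L' z) (at z)"
      using has_derivative_compose[OF B[OF that], of "\<lambda>b. (nav_norm (fst b) (snd b))\<^sup>2"]
        has_derivative_nav_norm_squared[OF dom[OF that], unfolded prod.collapse]
      unfolding L'_def M_def N_def by (simp add: B_def)
    then show ?thesis
    proof (rule has_derivative_transform_within_open[OF _ S(1) that])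
      show "(nav_norm (fst (B z)) (snd (B z)))\<^sup>2 = (F (fst z) (snd z))\<^sup>2" if "z \<in> S" for z
        using navigation_metric_eq_nav_norm[of V "\<phi> (fst z)" "dir_deriv \<phi> (snd z) (fst z)"] dom[OF that]
        by (simp add: F_def chart_metric_def B_def)
    qed
  qed
  obtain m' where m': "((\<lambda>b. nav_momentum (fst b) (snd b)) has_derivative m') (at (B (u, y)))"
    using differentiable_nav_momentum[OF dom[OF S(2)]] unfolding differentiable_def by auto
  have M': "(M has_derivative (\<lambda>h. m' (B' (u, y) h))) (at (u, y))"
    using has_derivative_compose[OF B[OF S(2)] m'] unfolding M_def B_def by simp
  have diff_along: "(\<lambda>z. dir_deriv \<phi> k (fst z)) differentiable (at (u, y))" for k
    using has_derivative_compose[OF fst smooth_on_has_derivative[OF smooth_on_dir_deriv[OF U(2)]]] u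
    unfolding differentiable_def by fastforce
  have "(\<lambda>z. L' z h) differentiable (at (u, y))" for h
  proof -
    have Md: "M differentiable (at (u, y))" using M' unfolding differentiable_def by blast
    have Nd: "N differentiable (at (u, y))"
      using differentiable_chain_at[of B "(u, y)" "\<lambda>b. nav_norm (fst b) (snd b)"]
        differentiable_nav_norm[OF dom[OF S(2)]] B[OF S(2)]
      unfolding N_def o_def by (auto simp: differentiable_def)
    have Vd: "(\<lambda>z. V (dir_deriv \<phi> (fst h) (fst z))) differentiable (at (u, y))"
      using diff_along[of "fst h"] bounded_linear.has_derivative[OF blV]
      unfolding differentiable_def by blast
    show ?thesis
      unfolding L'_def B'_def fst_conv snd_conv
      by (intro differentiable_mult differentiable_const differentiable_inner Md differentiable_diff
          differentiable_add differentiable_scaleR Nd Vd diff_along differentiable_dir_deriv2_joint[OF U u])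
  qed
  then obtain L'' where L'': "\<And>h. ((\<lambda>z. L' z h) has_derivative L'' h) (at (u, y))"
    unfolding differentiable_def by metis
  have L'y: "L' z (0, k) = 2 * (M z \<bullet> dir_deriv \<phi> k (fst z))" if "z \<in> S" for z k
  proof -
    have "fst z \<in> U" using that by (simp add: S_def)
    then show ?thesis
      using linear_0[OF lin] linear_0[OF V(1)] linear_0[OF linear_dir_deriv[OF smooth_on_dir_deriv[OF U(2)]]]
      by (simp add: L'_def B'_def)
  qed
  have L''y: "L'' (0, k) h = 2 * p h"
    if "((\<lambda>z. M z \<bullet> dir_deriv \<phi> k (fst z)) has_derivative p) (at (u, y))" for k p h
  proof -
    have "((\<lambda>z. 2 * (M z \<bullet> dir_deriv \<phi> k (fst z))) has_derivative L'' (0, k)) (at (u, y))"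
      by (rule has_derivative_transform_within_open[OF L'' S]) (rule L'y)
    from has_derivative_unique[OF this has_derivative_mult_right[OF that, of 2]] show ?thesis by simp
  qed
  define P' where "P' = (\<lambda>k h. M (u, y) \<bullet> dir_deriv (dir_deriv \<phi> k) (fst h) u
    + m' (B' (u, y) h) \<bullet> dir_deriv \<phi> k u)"
  have P': "((\<lambda>z. M z \<bullet> dir_deriv \<phi> k (fst z)) has_derivative P' k) (at (u, y))" for k
    using has_derivative_inner[OF M' has_derivative_compose[OF fst smooth_on_has_derivative[OF smooth_on_dir_deriv[OF U(2)]]]] u
    unfolding P'_def by simp
  have pos: "L'' (0, k) (0, k) > 0" if "k \<noteq> 0" for k
  proof -
    have z: "B' (u, y) (0, k) = (0, dir_deriv \<phi> k u)" "dir_deriv (dir_deriv \<phi> k) 0 u = 0"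
      using linear_0[OF lin[OF u]] linear_0[OF V(1)]
        linear_0[OF linear_dir_deriv[OF smooth_on_dir_deriv[OF U(2)] u]]
      by (simp_all add: B'_def)
    then show ?thesis
      using nav_momentum_derivative_pos[OF dom[OF S(2)], unfolded prod.collapse, OF m' nz[OF u that]]
      by (simp add: L''y[OF P'] P'_def)
  qed
  have along: "((\<lambda>t. M (c t, v t) \<bullet> dir_deriv \<phi> k (c t)) has_real_derivative P' k (y, a)) (at s)" for k
  proof -
    have "((\<lambda>t. (c t, v t)) has_derivative (\<lambda>r. r *\<^sub>R (y, a))) (at s)"
      using has_derivative_Pair[OF c[unfolded has_vector_derivative_def] v[unfolded has_vector_derivative_def]]
      by (simp add: y_def)
    from has_derivative_compose[OF this P'[of k, unfolded u_def y_def]]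
    have "((\<lambda>t. M (c t, v t) \<bullet> dir_deriv \<phi> k (c t)) has_derivative (\<lambda>r. P' k (r *\<^sub>R (y, a)))) (at s)"
      by simp
    moreover have "(\<lambda>r. P' k (r *\<^sub>R (y, a))) = (*) (P' k (y, a))"
      by (simp only: linear_scale[OF has_derivative_linear[OF P'[of k]]] real_scaleR_def mult.commute fun_eq_iff) simp
    ultimately show ?thesis by (simp only: has_field_derivative_def)
  qed
  have "(\<forall>i. a $ i + 2 * spray_coeff F u y $ i = 0) \<longleftrightarrow>
         (\<forall>l. L'' (0, axis l 1) (y, a) = L' (u, y) (axis l 1, 0))"
    by (rule spray_eq_iff_Euler_Lagrange[OF S L' L'' pos])
  also have "\<dots> \<longleftrightarrow> (\<forall>l. P' (axis l 1) (y, a) = M (u, y) \<bullet> (dir_deriv (dir_deriv \<phi> y) (axis l 1) u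
        - nav_norm (V (\<phi> u)) (dir_deriv \<phi> y u) *\<^sub>R V (dir_deriv \<phi> (axis l 1) u)))"
    unfolding L''y[OF P'] using linear_0[OF lin[OF u]] by (simp add: L'_def B'_def B_def N_def)
  also have "\<dots> \<longleftrightarrow> (\<forall>l. ((\<lambda>t. M (c t, v t) \<bullet> dir_deriv \<phi> (axis l 1) (c t)) has_real_derivative
        M (u, y) \<bullet> (dir_deriv (dir_deriv \<phi> y) (axis l 1) u
        - nav_norm (V (\<phi> u)) (dir_deriv \<phi> y u) *\<^sub>R V (dir_deriv \<phi> (axis l 1) u))) (at s))"
    by (simp only: has_real_derivative_iff_eq[OF along])
  finally show ?thesis unfolding F_def u_def y_def .
qed

section \<open>The acceleration of unit speed geodesics\<close>

lemma inner_skew_matrix: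
  fixes Q :: "real ^ 'm::finite ^ 'm"
  assumes "transpose Q = - Q"
  shows "x \<bullet> (Q *v y) = - ((Q *v x) \<bullet> y)" "x \<bullet> (Q *v x) = 0"
proof -
  show *: "x \<bullet> (Q *v y) = - ((Q *v x) \<bullet> y)" for x y
  proof -
    have "x v* Q = (- Q) *v x" by (simp add: assms flip: transpose_matrix_vector)
    also have "\<dots> = - (Q *v x)" by (simp add: vec_eq_iff matrix_vector_mult_def sum_negf)
    finally show ?thesis using dot_lmul_matrix[of x Q y] by simp
  qed
  show "x \<bullet> (Q *v x) = 0"
    using *[of x x] by (simp add: inner_commute)
qed

text \<open>For skew \<open>Q\<close> one has \<open>x \<bullet> (I + Q\<^sup>2) x = \<bar>x\<bar>\<^sup>2 - \<bar>Q x\<bar>\<^sup>2\<close>.\<close>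

lemma norm_skew_less_1:
  fixes Q :: "real ^ 'm::finite ^ 'm"
  assumes "transpose Q = - Q" "positive_definite (mat 1 + Q ** Q)" "norm x = 1"
  shows "norm (Q *v x) < 1"
proof -
  have "x \<noteq> 0" using assms by auto
  then have "x \<bullet> ((mat 1 + Q ** Q) *v x) > 0"
    using assms(2) by (simp add: positive_definite_def)
  then have "x \<bullet> x + x \<bullet> (Q *v (Q *v x)) > 0"
    by (simp add: matrix_vector_mult_add_rdistrib matrix_vector_mul_assoc inner_add_right)
  then have "(norm (Q *v x))\<^sup>2 < (norm x)\<^sup>2"
    unfolding power2_norm_eq_inner inner_skew_matrix(1)[OF assms(1), of x] by simp
  then show ?thesis using assms(3) by (simp add: abs_square_less_1)
qed

lemma has_real_derivative_inner:
  assumes "(f has_vector_derivative f') (at s)" "(g has_vector_derivative g') (at s)"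
  shows "((\<lambda>t. f t \<bullet> g t) has_real_derivative (f s \<bullet> g' + f' \<bullet> g s)) (at s)"
  using bounded_bilinear.has_vector_derivative[OF bounded_bilinear_inner assms]
  by (simp add: has_real_derivative_iff_has_vector_derivative)

lemma linear_inner_compose: "linear f \<Longrightarrow> linear (\<lambda>k. x \<bullet> f k)"
  by (auto simp: linear_iff inner_add_right)

lemma inner_derivative_zero:
  assumes "(f has_vector_derivative f') (at s)" "(g has_vector_derivative g') (at s)"
    and "open T" "s \<in> T" "\<And>t. t \<in> T \<Longrightarrow> f t \<bullet> g t = K"
  shows "f s \<bullet> g' + f' \<bullet> g s = 0"
proof (rule DERIV_unique)
  show "((\<lambda>t. K) has_real_derivative (f s \<bullet> g' + f' \<bullet> g s)) (at s)"
    using has_real_derivative_inner[OF assms(1,2)] assms(3-5)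
    by (rule has_field_derivative_transform_within_open)
qed simp

lemma has_vector_derivative_matrix_vector_mult:
  fixes A :: "real ^ 'm::finite ^ 'k::finite"
  assumes "(f has_vector_derivative f') F"
  shows "((\<lambda>t. A *v f t) has_vector_derivative A *v f') F"
  by (rule bounded_linear.has_vector_derivative[OF matrix_vector_mul_bounded_linear assms])

lemma has_vector_derivative_smooth_compose:
  assumes "smooth_on U f" "c s \<in> U" "(c has_vector_derivative c') (at s)"
  shows "((\<lambda>t. f (c t)) has_vector_derivative dir_deriv f c' (c s)) (at s)"
  using has_derivative_compose[OF assms(3)[unfolded has_vector_derivative_def]
      smooth_on_has_derivative[OF assms(1,2)]] linear_scale[OF linear_dir_deriv[OF assms(1,2)]]
  by (simp add: has_vector_derivative_def)

lemma has_vector_derivative_smooth_compose2: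
  assumes U: "open U" "smooth_on U f" "c s \<in> U"
    and c: "(c has_vector_derivative v s) (at s)" and v: "(v has_vector_derivative a) (at s)"
  shows "((\<lambda>t. dir_deriv f (v t) (c t)) has_vector_derivative
    (dir_deriv (dir_deriv f (v s)) (v s) (c s) + dir_deriv f a (c s))) (at s)"
proof -
  note J = has_derivative_dir_deriv_joint[OF U, of "v s"]
  have cv: "((\<lambda>t. (c t, v t)) has_derivative (\<lambda>r. r *\<^sub>R (v s, a))) (at s)"
    using has_derivative_Pair[OF c[unfolded has_vector_derivative_def] v[unfolded has_vector_derivative_def]]
    by simp
  have "linear (\<lambda>h. dir_deriv (dir_deriv f (v s)) (fst h) (c s) + dir_deriv f (snd h) (c s))"
    using J has_derivative_linear by blast
  from has_derivative_compose[OF cv J] linear_scale[OF this, of _ "(v s, a)"]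
  show ?thesis
    by (simp add: has_vector_derivative_def)
qed

lemma dim_tangent_sphere:
  fixes x :: "real ^ ('n::finite + 1)"
  assumes "x \<noteq> 0"
  shows "dim (tangent_sphere x) = CARD('n)"
  using dim_hyperplane[OF assms] unfolding tangent_sphere_def by simp

lemma subspace_tangent_sphere: "subspace (tangent_sphere x)"
  unfolding tangent_sphere_def by (rule subspace_hyperplane)

lemma sphere_chartD:
  fixes \<phi> :: "real ^ 'n::finite \<Rightarrow> real ^ ('n + 1)"
  assumes "sphere_chart U \<phi>"
  shows "open U" "smooth_on U \<phi>" "\<And>u. u \<in> U \<Longrightarrow> inj (\<lambda>h. dir_deriv \<phi> h u)"
    "\<And>u. u \<in> U \<Longrightarrow> norm (\<phi> u) = 1"
    "continuous_on (\<phi> ` U) (inv_into U \<phi>)" "openin (top_of_set (sphere 0 1)) (\<phi> ` U)"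
proof -
  note h = assms[unfolded sphere_chart_def]
  then have hom: "homeomorphism U (\<phi> ` U) \<phi> (inv_into U \<phi>)" by blast
  show "open U" "smooth_on U \<phi>" "openin (top_of_set (sphere 0 1)) (\<phi> ` U)" using h by auto
  show "inj (\<lambda>h. dir_deriv \<phi> h u)" if "u \<in> U" for u using h that by auto
  show "continuous_on (\<phi> ` U) (inv_into U \<phi>)" using hom by (simp add: homeomorphism_def)
  show "norm (\<phi> u) = 1" if "u \<in> U" for u
  proof -
    have "\<phi> ` U \<subseteq> sphere 0 1" using h openin_imp_subset by blast
    then show ?thesis using that by auto
  qed
qed

text \<open>Differentiating \<open>\<phi> \<bullet> \<phi> = 1\<close> gives one inclusion, and the dimensions agree.\<close>

lemma range_chart_derivative:
  fixes \<phi> :: "real ^ 'n::finite \<Rightarrow> real ^ ('n + 1)"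
  assumes chart: "sphere_chart U \<phi>" and u: "u \<in> U"
  shows "range (\<lambda>h. dir_deriv \<phi> h u) = tangent_sphere (\<phi> u)"
proof -
  note ch = sphere_chartD[OF chart]
  have lin: "linear (\<lambda>h. dir_deriv \<phi> h u)" by (rule linear_dir_deriv[OF ch(2) u])
  have sub: "dir_deriv \<phi> h u \<in> tangent_sphere (\<phi> u)" for h
  proof -
    note d = smooth_on_has_derivative[OF ch(2) u]
    have "((\<lambda>u. \<phi> u \<bullet> \<phi> u) has_derivative (\<lambda>h. \<phi> u \<bullet> dir_deriv \<phi> h u + dir_deriv \<phi> h u \<bullet> \<phi> u)) (at u)"
      by (rule has_derivative_inner[OF d d])
    then have "((\<lambda>u. 1) has_derivative (\<lambda>h. \<phi> u \<bullet> dir_deriv \<phi> h u + dir_deriv \<phi> h u \<bullet> \<phi> u)) (at u)"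
      by (rule has_derivative_transform_within_open[OF _ ch(1) u]) (simp add: dot_square_norm ch(4))
    from fun_cong[OF has_derivative_unique[OF this has_derivative_const], of h]
    show ?thesis by (simp add: tangent_sphere_def inner_commute)
  qed
  have "\<phi> u \<noteq> 0" using ch(4)[OF u] by auto
  have "dim (range (\<lambda>h. dir_deriv \<phi> h u)) = dim (UNIV :: (real ^ 'n) set)"
    by (rule dim_image_eq[OF lin]) (use ch(3)[OF u] in auto)
  then show ?thesis
    using sub dim_tangent_sphere[OF \<open>\<phi> u \<noteq> 0\<close>]
    by (intro subspace_dim_equal linear_subspace_image[OF lin] subspace_UNIV subspace_tangent_sphere) auto
qed

lemma nav_norm_unit:
  assumes "norm w < 1" "norm (y - w) = 1"
  shows "y \<noteq> 0" "nav_norm w y = 1"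
proof -
  show "y \<noteq> 0" using assms by auto
  note n = nav_norm_solves[OF assms(1) this]
  have "\<exists>!f. f > 0 \<and> norm (y - f *\<^sub>R w) = f"
    by (rule navigation_metric_ex1[OF assms(1) \<open>y \<noteq> 0\<close>])
  moreover have "1 > (0 :: real) \<and> norm (y - 1 *\<^sub>R w) = 1" using assms by simp
  ultimately show "nav_norm w y = 1" using n unfolding relative_velocity_def by blast
qed

text \<open>The chart disappears from the geodesic equation: with \<open>w = \<gamma>\<^sub>1 - Q \<gamma>\<close> and \<open>m = 1 + w \<bullet> Q \<gamma>\<close> the momentum
  is \<open>w / m\<close>, the second derivatives of \<open>\<phi>\<close> cancel by symmetry, and the Euler-Lagrange equation says
  that \<open>z = w' - Q w - (m' / m) w\<close> is orthogonal to the range of \<open>d\<phi>\<close>, the tangent space. Since \<open>w\<close> is a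
  unit tangent vector with \<open>w \<bullet> w' = 0\<close>, pairing \<open>z\<close> with \<open>w\<close> gives \<open>m' = 0\<close>. The remaining \<open>w' - Q w\<close> is a
  multiple of \<open>\<gamma>\<close>, and differentiating \<open>\<gamma> \<bullet> w = 0\<close> shows that the factor is \<open>- 1\<close>.\<close>

lemma spray_iff_acceleration:
  fixes Q :: "real ^ ('n::finite + 1) ^ ('n + 1)" and \<phi> :: "real ^ 'n \<Rightarrow> real ^ ('n + 1)"
  assumes Q: "transpose Q = - Q" "positive_definite (mat 1 + Q ** Q)"
    and chart: "sphere_chart U \<phi>" and T: "open T" "s \<in> T"
    and c: "\<And>t. t \<in> T \<Longrightarrow> c t \<in> U" "\<And>t. t \<in> T \<Longrightarrow> \<gamma> t = \<phi> (c t)"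
      "\<And>t. t \<in> T \<Longrightarrow> (c has_vector_derivative v t) (at t)"
    and v: "(v has_vector_derivative a) (at s)"
    and \<gamma>: "\<And>t. t \<in> T \<Longrightarrow> (\<gamma> has_vector_derivative \<gamma>\<^sub>1 t) (at t)"
      "(\<gamma>\<^sub>1 has_vector_derivative \<gamma>\<^sub>2) (at s)"
    and unit: "\<And>t. t \<in> T \<Longrightarrow> norm (\<gamma>\<^sub>1 t - Q *v \<gamma> t) = 1"
  shows "(\<forall>i. a $ i + 2 * spray_coeff (chart_metric (navigation_metric (\<lambda>p. Q *v p)) \<phi>) (c s) (v s) $ i = 0)
    \<longleftrightarrow> \<gamma>\<^sub>2 = Q *v \<gamma>\<^sub>1 s + Q *v (\<gamma>\<^sub>1 s - Q *v \<gamma> s) - \<gamma> s"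
proof -
  note ch = sphere_chartD[OF chart]
  note skew = inner_skew_matrix[OF Q(1)]
  define w where "w = (\<lambda>t. \<gamma>\<^sub>1 t - Q *v \<gamma> t)"
  define w' where "w' = \<gamma>\<^sub>2 - Q *v \<gamma>\<^sub>1 s"
  define m where "m = (\<lambda>t. 1 + w t \<bullet> (Q *v \<gamma> t))"
  define m' where "m' = w s \<bullet> (Q *v \<gamma>\<^sub>1 s) + w' \<bullet> (Q *v \<gamma> s)"
  have \<gamma>n: "norm (\<gamma> t) = 1" if "t \<in> T" for t using c ch(4) that by simp
  have Qn: "norm (Q *v \<gamma> t) < 1" if "t \<in> T" for t by (rule norm_skew_less_1[OF Q \<gamma>n[OF that]])
  have \<gamma>\<^sub>1: "\<gamma>\<^sub>1 t = dir_deriv \<phi> (v t) (c t)" if "t \<in> T" for t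
  proof (rule vector_derivative_unique_at)
    show "(\<gamma> has_vector_derivative \<gamma>\<^sub>1 t) (at t)" by (rule \<gamma>(1)[OF that])
    show "(\<gamma> has_vector_derivative dir_deriv \<phi> (v t) (c t)) (at t)"
      by (rule has_vector_derivative_transform_within_open[OF has_vector_derivative_smooth_compose[OF ch(2) c(1)[OF that] c(3)[OF that]] T(1) that])
        (simp add: c(2))
  qed
  have dw: "(w has_vector_derivative w') (at s)"
    unfolding w_def w'_def
    by (intro has_vector_derivative_diff \<gamma>(2) has_vector_derivative_matrix_vector_mult \<gamma>(1) T(2))
  have dm: "(m has_real_derivative m') (at s)"
    unfolding m_def m'_def
    using DERIV_add[OF DERIV_const has_real_derivative_inner[OF dw has_vector_derivative_matrix_vector_mult[OF \<gamma>(1)[OF T(2)]]]]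
    by simp
  have orth: "\<gamma> t \<bullet> w t = 0" if "t \<in> T" for t
  proof -
    have "\<gamma> t \<bullet> \<gamma>\<^sub>1 t + \<gamma>\<^sub>1 t \<bullet> \<gamma> t = 0"
      by (rule inner_derivative_zero[OF \<gamma>(1)[OF that] \<gamma>(1)[OF that] T(1) that])
        (simp add: dot_square_norm \<gamma>n)
    then show ?thesis by (simp add: w_def inner_diff_right skew(2) inner_commute)
  qed
  have \<gamma>w': "\<gamma> s \<bullet> w' + \<gamma>\<^sub>1 s \<bullet> w s = 0"
    by (rule inner_derivative_zero[OF \<gamma>(1)[OF T(2)] dw T orth])
  have ww: "w t \<bullet> w t = 1" if "t \<in> T" for t
    using unit[OF that] by (simp add: dot_square_norm w_def)
  have ww': "w s \<bullet> w' = 0"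
    using inner_derivative_zero[OF dw dw T ww] by (simp add: inner_commute)
  have \<gamma>w': "\<gamma> s \<bullet> w' - \<gamma> s \<bullet> (Q *v w s) = - 1"
  proof -
    have "\<gamma>\<^sub>1 s \<bullet> w s = 1 + (Q *v \<gamma> s) \<bullet> w s"
      using ww[OF T(2)] by (simp add: w_def inner_diff_left)
    then show ?thesis using \<gamma>w' by (simp add: skew(1)[of "\<gamma> s"])
  qed
  have nav: "\<gamma>\<^sub>1 t \<noteq> 0" "nav_norm (Q *v \<gamma> t) (\<gamma>\<^sub>1 t) = 1" if "t \<in> T" for t
    using nav_norm_unit[OF Qn[OF that] unit[OF that]] by auto
  have rel: "relative_velocity (Q *v \<gamma> t) (\<gamma>\<^sub>1 t) = w t" if "t \<in> T" for t
    by (simp add: relative_velocity_def nav(2)[OF that] w_def)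
  have mpos: "m t > 0" if "t \<in> T" for t
    using nav_denominator_pos[OF Qn[OF that] nav(1)[OF that]] nav(2)[OF that] rel[OF that]
    by (simp add: m_def)
  have mom: "nav_momentum (Q *v \<phi> (c t)) (dir_deriv \<phi> (v t) (c t)) = (1 / m t) *\<^sub>R w t" if "t \<in> T" for t
    using nav(2)[OF that] rel[OF that] unfolding nav_momentum_def \<gamma>\<^sub>1[OF that] c(2)[OF that]
    by (simp add: m_def \<gamma>\<^sub>1[OF that] c(2)[OF that])
  have "v s \<noteq> 0"
    using nav(1)[OF T(2)] linear_0[OF linear_dir_deriv[OF ch(2) c(1)[OF T(2)]]] \<gamma>\<^sub>1[OF T(2)] by auto
  define z where "z = w' - Q *v w s - (m' / m s) *\<^sub>R w s"
  have EL: "((\<lambda>t. nav_momentum (Q *v \<phi> (c t)) (dir_deriv \<phi> (v t) (c t)) \<bullet> dir_deriv \<phi> k (c t))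
      has_real_derivative nav_momentum (Q *v \<phi> (c s)) (dir_deriv \<phi> (v s) (c s)) \<bullet>
        (dir_deriv (dir_deriv \<phi> (v s)) k (c s)
        - nav_norm (Q *v \<phi> (c s)) (dir_deriv \<phi> (v s) (c s)) *\<^sub>R (Q *v dir_deriv \<phi> k (c s)))) (at s)
      \<longleftrightarrow> z \<bullet> dir_deriv \<phi> k (c s) = 0" (is "(?f has_real_derivative ?r) _ \<longleftrightarrow> _") for k
  proof -
    define e where "e = (\<lambda>t. dir_deriv \<phi> k (c t))"
    define e' where "e' = dir_deriv (dir_deriv \<phi> k) (v s) (c s)"
    have de: "(e has_vector_derivative e') (at s)"
      unfolding e_def e'_def
      by (rule has_vector_derivative_smooth_compose[OF smooth_on_dir_deriv[OF ch(2)] c(1)[OF T(2)] c(3)[OF T(2)]])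
    have "((\<lambda>t. (w t \<bullet> e t) / m t) has_real_derivative
        ((w s \<bullet> e' + w' \<bullet> e s) * m s - (w s \<bullet> e s) * m') / (m s * m s)) (at s)"
      using mpos[OF T(2)] by (intro DERIV_divide has_real_derivative_inner dw de dm) auto
    then have d: "(?f has_real_derivative ((w s \<bullet> e' + w' \<bullet> e s) * m s - (w s \<bullet> e s) * m') / (m s * m s)) (at s)"
      by (rule has_field_derivative_transform_within_open[OF _ T]) (simp add: mom e_def)
    have r: "?r = (w s \<bullet> e' - w s \<bullet> (Q *v e s)) / m s"
      unfolding mom[OF T(2)] using nav(2)[OF T(2)] dir_deriv_commute[OF ch(1,2) c(1)[OF T(2)], of "v s" k]
      by (simp add: \<gamma>\<^sub>1[OF T(2)] c(2)[OF T(2)] e_def e'_def inner_diff_right diff_divide_distrib)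
    have "(?f has_real_derivative ?r) (at s) \<longleftrightarrow>
      ((w s \<bullet> e' + w' \<bullet> e s) * m s - (w s \<bullet> e s) * m') / (m s * m s) = (w s \<bullet> e' - w s \<bullet> (Q *v e s)) / m s"
      unfolding r by (rule has_real_derivative_iff_eq[OF d])
    also have "\<dots> \<longleftrightarrow> w' \<bullet> e s + w s \<bullet> (Q *v e s) - m' / m s * (w s \<bullet> e s) = 0"
    proof -
      have "((w s \<bullet> e' + w' \<bullet> e s) * m s - (w s \<bullet> e s) * m') / (m s * m s) - (w s \<bullet> e' - w s \<bullet> (Q *v e s)) / m s
          = (w' \<bullet> e s + w s \<bullet> (Q *v e s) - m' / m s * (w s \<bullet> e s)) / m s"
        using mpos[OF T(2)] by (simp add: field_simps)
      then show ?thesis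
        using mpos[OF T(2)] by (metis divide_eq_0_iff eq_iff_diff_eq_0 less_irrefl)
    qed
    also have "\<dots> \<longleftrightarrow> z \<bullet> e s = 0"
      by (simp add: z_def inner_diff_left skew(1)[of "w s"])
    finally show ?thesis by (simp add: e_def)
  qed
  have "(\<forall>i. a $ i + 2 * spray_coeff (chart_metric (navigation_metric (\<lambda>p. Q *v p)) \<phi>) (c s) (v s) $ i = 0)
      \<longleftrightarrow> (\<forall>l. z \<bullet> dir_deriv \<phi> (axis l 1) (c s) = 0)"
    using navigation_spray_iff[OF ch(1-3) _ _ c(1)[OF T(2)] \<open>v s \<noteq> 0\<close> c(3)[OF T(2)] v, of "\<lambda>p. Q *v p"]
      norm_skew_less_1[OF Q ch(4)]
    unfolding fst_conv snd_conv EL by simp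
  also have "\<dots> \<longleftrightarrow> (\<forall>\<xi>\<in>tangent_sphere (\<gamma> s). z \<bullet> \<xi> = 0)"
  proof -
    have "linear (\<lambda>k. z \<bullet> dir_deriv \<phi> k (c s))"
      by (rule linear_inner_compose[OF linear_dir_deriv[OF ch(2) c(1)[OF T(2)]]])
    from linear_axis_expansion[OF this]
    have all: "z \<bullet> dir_deriv \<phi> k (c s) = 0" if "\<And>l. z \<bullet> dir_deriv \<phi> (axis l 1) (c s) = 0" for k
      using linear_axis_expansion[OF \<open>linear (\<lambda>k. z \<bullet> dir_deriv \<phi> k (c s))\<close>, of k] that by simp
    show ?thesis
      unfolding c(2)[OF T(2)] range_chart_derivative[OF chart c(1)[OF T(2)], symmetric]
      using all by blast
  qed
  also have "\<dots> \<longleftrightarrow> w' = Q *v w s - \<gamma> s"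
  proof
    assume normal: "\<forall>\<xi>\<in>tangent_sphere (\<gamma> s). z \<bullet> \<xi> = 0"
    have "z \<bullet> w s = 0" using normal orth[OF T(2)] by (simp add: tangent_sphere_def)
    moreover have "w s \<bullet> z = - (m' / m s)"
      by (simp add: z_def inner_diff_right ww' ww[OF T(2)] skew(2))
    ultimately have "m' / m s = 0" by (simp add: inner_commute)
    then have z: "z = w' - Q *v w s" by (simp add: z_def)
    have gg: "\<gamma> s \<bullet> \<gamma> s = 1" using \<gamma>n[OF T(2)] by (simp add: dot_square_norm)
    have "\<gamma> s \<bullet> z = - 1" using \<gamma>w' by (simp add: z inner_diff_right)
    then have t: "\<gamma> s \<bullet> (z + \<gamma> s) = 0" by (simp add: inner_add_right gg)
    then have "z \<bullet> (z + \<gamma> s) = 0" using normal by (simp add: tangent_sphere_def)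
    then have "(z + \<gamma> s) \<bullet> (z + \<gamma> s) = 0" using t by (simp add: inner_add_left)
    then have "z + \<gamma> s = 0" by (simp only: inner_eq_zero_iff)
    then show "w' = Q *v w s - \<gamma> s" by (simp add: z algebra_simps)
  next
    assume w': "w' = Q *v w s - \<gamma> s"
    have "\<gamma>\<^sub>1 s = Q *v \<gamma> s + w s" by (simp add: w_def)
    \<comment> \<open>\<open>Q w \<bullet> Q \<gamma>\<close> and \<open>w \<bullet> Q (Q \<gamma>)\<close> cancel, while \<open>\<gamma> \<bullet> Q \<gamma>\<close> and \<open>w \<bullet> Q w\<close> vanish.\<close>
    then have "m' = 0"
      unfolding m'_def w'
      by (simp add: inner_diff_left matrix_vector_right_distrib inner_add_right skew(2) skew(1)[of "w s" "Q *v \<gamma> s"])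
    then show "\<forall>\<xi>\<in>tangent_sphere (\<gamma> s). z \<bullet> \<xi> = 0"
      by (simp add: z_def w' tangent_sphere_def)
  qed
  also have "\<dots> \<longleftrightarrow> \<gamma>\<^sub>2 = Q *v \<gamma>\<^sub>1 s + Q *v (\<gamma>\<^sub>1 s - Q *v \<gamma> s) - \<gamma> s"
    unfolding w'_def w_def by (simp only: diff_eq_eq) (simp add: algebra_simps)
  finally show ?thesis .
qed

section \<open>Coordinates of a curve on the sphere\<close>

text \<open>Near \<open>c s\<close> the map \<open>P \<circ> f\<close> is the identity up to a small relative error, and \<open>c\<close> stays there by
  continuity. So the increments of \<open>c\<close> are first bounded by twice those of \<open>P \<circ> f \<circ> c\<close>, hence by a
  multiple of \<open>\<bar>t - s\<bar>\<close>, and then agree with them up to \<open>o(\<bar>t - s\<bar>)\<close>.\<close>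

lemma has_derivative_lift:
  fixes f :: "'a::real_normed_vector \<Rightarrow> 'b::real_normed_vector" and c :: "'c::real_normed_vector \<Rightarrow> 'a"
  assumes c: "continuous (at s) c" and f: "(f has_derivative A) (at (c s))"
    and P: "bounded_linear P" "\<And>h. P (A h) = h"
    and fc: "((\<lambda>t. f (c t)) has_derivative B) (at s)"
  shows "(c has_derivative (\<lambda>h. P (B h))) (at s)"
proof -
  define g D where "g = (\<lambda>x. P (f x))" and "D = (\<lambda>h. P (B h))"
  have g: "(g has_derivative (\<lambda>h. h)) (at (c s))"
    using bounded_linear.has_derivative[OF P(1) f] by (simp add: g_def P(2))
  have gc: "((\<lambda>t. g (c t)) has_derivative D) (at s)"
    unfolding g_def D_def by (rule bounded_linear.has_derivative[OF P(1) fc])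
  have "bounded_linear D" using gc has_derivative_bounded_linear by blast
  then obtain K where K: "K > 0" "\<And>h. norm (D h) \<le> norm h * K"
    using bounded_linear.pos_bounded by blast
  have "\<exists>d>0. \<forall>t. norm (t - s) < d \<longrightarrow> norm (c t - c s - D (t - s)) \<le> e * norm (t - s)"
    if e: "e > 0" for e
  proof -
    define e1 e2 where "e1 = min (1/2) (e / (4 * (K + 1)))" and "e2 = min 1 (e / 2)"
    have e12: "e1 > 0" "e2 > 0" "e1 \<le> 1/2" "e2 \<le> 1" "e2 \<le> e / 2" "e1 * (4 * (K + 1)) \<le> e"
    proof -
      show "e1 * (4 * (K + 1)) \<le> e"
        using K pos_le_divide_eq[of "4 * (K + 1)" e1 e] by (simp add: e1_def)
      show "e1 \<le> 1/2" unfolding e1_def by (rule min.cobounded1)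
    qed (use e K in \<open>auto simp: e1_def e2_def\<close>)
    obtain d1 where d1: "d1 > 0"
      "\<And>y. norm (y - c s) < d1 \<Longrightarrow> norm (g y - g (c s) - (y - c s)) \<le> e1 * norm (y - c s)"
      using g e12(1) unfolding has_derivative_at_alt by blast
    obtain d2 where d2: "d2 > 0"
      "\<And>t. norm (t - s) < d2 \<Longrightarrow> norm (g (c t) - g (c s) - D (t - s)) \<le> e2 * norm (t - s)"
      using gc e12(2) unfolding has_derivative_at_alt by blast
    obtain d3 where d3: "d3 > 0" "\<And>t. norm (t - s) < d3 \<Longrightarrow> norm (c t - c s) < d1"
      using c d1(1) unfolding continuous_at_eps_delta dist_norm by metis
    have "norm (c t - c s - D (t - s)) \<le> e * norm (t - s)" if t: "norm (t - s) < min d2 d3" for t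
    proof -
      define a b where "a = c t - c s" and "b = g (c t) - g (c s)"
      have 1: "norm (b - a) \<le> e1 * norm a" using d1(2) d3(2) t by (simp add: a_def b_def)
      have 2: "norm (b - D (t - s)) \<le> e2 * norm (t - s)" using d2(2) t by (simp add: b_def)
      have "e1 * norm a \<le> 1/2 * norm a" by (intro mult_right_mono e12) auto
      moreover have "e2 * norm (t - s) \<le> 1 * norm (t - s)" by (intro mult_right_mono e12) auto
      moreover have "norm a \<le> norm (b - a) + norm (b - D (t - s)) + norm (D (t - s))"
        by norm
      ultimately have a: "norm a \<le> 2 * (K + 1) * norm (t - s)"
        using 1 2 K(2)[of "t - s"] by (simp add: algebra_simps)
      have "norm (a - D (t - s)) \<le> norm (b - a) + norm (b - D (t - s))" by norm
      also have "\<dots> \<le> e1 * (2 * (K + 1) * norm (t - s)) + e2 * norm (t - s)"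
        using 1 2 mult_left_mono[OF a less_imp_le[OF e12(1)]] by linarith
      also have "\<dots> = (e1 * (4 * (K + 1)) / 2 + e2) * norm (t - s)" by (simp add: algebra_simps)
      also have "\<dots> \<le> e * norm (t - s)" using e12(5,6) by (intro mult_right_mono) auto
      finally show ?thesis by (simp add: a_def)
    qed
    then show ?thesis using d2(1) d3(1) by (intro exI[of _ "min d2 d3"]) auto
  qed
  then have "(c has_derivative D) (at s)"
    using \<open>bounded_linear D\<close> unfolding has_derivative_at_alt by blast
  then show ?thesis by (simp add: D_def)
qed

lemma differentiable_prod_finite:
  fixes f :: "'i \<Rightarrow> real \<Rightarrow> real"
  assumes "finite I" "\<And>i. i \<in> I \<Longrightarrow> f i differentiable (at s)"
  shows "(\<lambda>t. \<Prod>i\<in>I. f i t) differentiable (at s)"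
  using assms by (induction I rule: finite_induct) auto

lemma differentiable_det:
  fixes A :: "real \<Rightarrow> real ^ 'n::finite ^ 'n"
  assumes "\<And>i j. (\<lambda>t. A t $ i $ j) differentiable (at s)"
  shows "(\<lambda>t. det (A t)) differentiable (at s)"
  unfolding det_def
  by (intro differentiable_sum differentiable_mult differentiable_const ballI
      differentiable_prod_finite[where f = "\<lambda>i t. A t $ i $ p i" for p] assms)
     (auto simp: finite_permutations)

lemma differentiable_vec_iff:
  fixes f :: "real \<Rightarrow> real ^ 'n::finite"
  shows "f differentiable (at s) \<longleftrightarrow> (\<forall>i. (\<lambda>t. f t $ i) differentiable (at s))"
  unfolding differentiable_componentwise_within[of f] by (auto simp: Basis_vec_def inner_axis)

text \<open>Cramer's rule writes the solution as a quotient of determinants.\<close>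

lemma differentiable_linear_system_solution:
  fixes A :: "real \<Rightarrow> real ^ 'n::finite ^ 'n"
  assumes A: "\<And>i j. (\<lambda>t. A t $ i $ j) differentiable (at s)"
    and b: "\<And>i. (\<lambda>t. b t $ i) differentiable (at s)"
    and T: "open T" "s \<in> T" and nz: "\<And>t. t \<in> T \<Longrightarrow> det (A t) \<noteq> 0"
    and sol: "\<And>t. t \<in> T \<Longrightarrow> A t *v x t = b t"
  shows "x differentiable (at s)"
proof -
  have "(\<lambda>t. \<chi> k. det (\<chi> i j. if j = k then b t $ i else A t $ i $ j) / det (A t)) differentiable (at s)"
    unfolding differentiable_vec_iff vec_lambda_beta
  proof (intro allI differentiable_divide differentiable_det A nz T(2))
    show "(\<lambda>t. (\<chi> i j. if j = k then b t $ i else A t $ i $ j) $ i $ j) differentiable (at s)" for i j k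
      by (cases "j = k") (simp_all add: A b)
  qed
  then obtain d where d: "((\<lambda>t. \<chi> k. det (\<chi> i j. if j = k then b t $ i else A t $ i $ j) / det (A t)) has_derivative d) (at s)"
    unfolding differentiable_def by blast
  have "(x has_derivative d) (at s)"
  proof (rule has_derivative_transform_within_open[OF d T])
    show "(\<chi> k. det (\<chi> i j. if j = k then b t $ i else A t $ i $ j) / det (A t)) = x t" if "t \<in> T" for t
      using cramer[OF nz[OF that], of "x t" "b t"] sol[OF that] by simp
  qed
  then show ?thesis unfolding differentiable_def by blast
qed

lemma open_chart_times:
  fixes \<phi> :: "real ^ 'n::finite \<Rightarrow> real ^ ('n + 1)"
  assumes "sphere_chart U \<phi>" "continuous_on UNIV \<gamma>" "range \<gamma> \<subseteq> sphere 0 1"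
  shows "open {t :: real. \<gamma> t \<in> \<phi> ` U}"
proof -
  obtain O' where O': "open O'" "\<phi> ` U = sphere 0 1 \<inter> O'"
    using sphere_chartD(6)[OF assms(1)] unfolding openin_open by blast
  have "\<gamma> t \<in> sphere 0 1" for t using assms(3) by (rule subsetD) simp
  then have "{t. \<gamma> t \<in> \<phi> ` U} = \<gamma> -` O'" using O'(2) by blast
  then show ?thesis using open_vimage[OF O'(1) assms(2)] by simp
qed

text \<open>A linear left inverse of \<open>d\<phi>\<close> gives the velocity \<open>v\<close> of the coordinates. It solves
  \<open>G v = (e\<^sub>i \<bullet> \<gamma>\<^sub>1)\<^sub>i\<close>, where \<open>e\<^sub>i = \<partial>\<phi>/\<partial>u\<^sup>i\<close> and \<open>G\<close> is their Gram matrix, that is, the round metric in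
  coordinates. All data of this system are differentiable along the curve, hence so is \<open>v\<close>.\<close>

lemma chart_coordinates_twice_differentiable:
  fixes \<phi> :: "real ^ 'n::finite \<Rightarrow> real ^ ('n + 1)"
  assumes chart: "sphere_chart U \<phi>"
    and \<gamma>: "\<And>s. (\<gamma> has_vector_derivative \<gamma>\<^sub>1 s) (at s)" "\<And>s. (\<gamma>\<^sub>1 has_vector_derivative \<gamma>\<^sub>2 s) (at s)"
    and sphere: "range \<gamma> \<subseteq> sphere 0 1"
  obtains v a where "\<And>s. \<gamma> s \<in> \<phi> ` U \<Longrightarrow> ((\<lambda>s. inv_into U \<phi> (\<gamma> s)) has_vector_derivative v s) (at s)"
    "\<And>s. \<gamma> s \<in> \<phi> ` U \<Longrightarrow> (v has_vector_derivative a s) (at s)"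
proof -
  note ch = sphere_chartD[OF chart]
  define c where "c = (\<lambda>s. inv_into U \<phi> (\<gamma> s))"
  define T where "T = {t. \<gamma> t \<in> \<phi> ` U}"
  have cont: "continuous_on UNIV \<gamma>"
    using \<gamma>(1) by (meson continuous_at_imp_continuous_on has_vector_derivative_continuous)
  have T: "open T" unfolding T_def by (rule open_chart_times[OF chart cont sphere])
  have c: "c t \<in> U" "\<phi> (c t) = \<gamma> t" if "t \<in> T" for t
    using that unfolding c_def T_def by (auto intro: inv_into_into f_inv_into_f)
  have "continuous_on T c"
    unfolding c_def
    by (rule continuous_on_compose2[OF ch(5) continuous_on_subset[OF cont]]) (auto simp: T_def)
  then have c_cont: "continuous (at t) c" if "t \<in> T" for t
    using T that continuous_on_eq_continuous_at by blast
  have lin: "linear (\<lambda>h. dir_deriv \<phi> h (c t))" if "t \<in> T" for t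
    by (rule linear_dir_deriv[OF ch(2) c(1)[OF that]])
  have "c differentiable (at t)" if t: "t \<in> T" for t
  proof -
    obtain P where P: "linear P" "P \<circ> (\<lambda>h. dir_deriv \<phi> h (c t)) = id"
      using linear_injective_left_inverse[OF lin[OF t] ch(3)[OF c(1)[OF t]]] by blast
    have "((\<lambda>t. \<phi> (c t)) has_derivative (\<lambda>h. h *\<^sub>R \<gamma>\<^sub>1 t)) (at t)"
      by (rule has_derivative_transform_within_open[OF \<gamma>(1)[unfolded has_vector_derivative_def] T t])
        (simp add: c)
    from has_derivative_lift[OF c_cont[OF t] smooth_on_has_derivative[OF ch(2) c(1)[OF t]] _ _ this, of P]
    show ?thesis
      using P unfolding differentiable_def
      by (auto simp: linear_conv_bounded_linear fun_eq_iff)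
  qed
  define v where "v = (\<lambda>t. vector_derivative c (at t))"
  have v: "(c has_vector_derivative v t) (at t)" if "t \<in> T" for t
    using \<open>\<And>t. t \<in> T \<Longrightarrow> c differentiable (at t)\<close>[OF that] unfolding v_def
    by (simp add: vector_derivative_works)
  have \<gamma>\<^sub>1: "\<gamma>\<^sub>1 t = dir_deriv \<phi> (v t) (c t)" if "t \<in> T" for t
  proof (rule vector_derivative_unique_at)
    show "(\<gamma> has_vector_derivative \<gamma>\<^sub>1 t) (at t)" by (rule \<gamma>(1))
    show "(\<gamma> has_vector_derivative dir_deriv \<phi> (v t) (c t)) (at t)"
      by (rule has_vector_derivative_transform_within_open[OF
            has_vector_derivative_smooth_compose[OF ch(2) c(1)[OF that] v[OF that]] T that])
        (simp add: c)
  qed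
  define e where "e = (\<lambda>i t. dir_deriv \<phi> (axis i 1) (c t))"
  define G where "G = (\<lambda>t. \<chi> i j. e i t \<bullet> e j t)"
  have G: "(G t *v k) $ i = e i t \<bullet> dir_deriv \<phi> k (c t)" if "t \<in> T" for t k i
  proof -
    have "linear (\<lambda>k. e i t \<bullet> dir_deriv \<phi> k (c t))"
      by (rule linear_inner_compose[OF lin[OF that]])
    from linear_axis_expansion[OF this] show ?thesis
      by (simp add: G_def e_def matrix_vector_mult_def)
  qed
  have det: "det (G t) \<noteq> 0" if t: "t \<in> T" for t
  proof -
    have "k = 0" if "G t *v k = 0" for k
    proof -
      have "e i t \<bullet> dir_deriv \<phi> k (c t) = 0" for i using G[OF t, of k i] that by simp
      moreover have "linear (\<lambda>h. dir_deriv \<phi> h (c t) \<bullet> dir_deriv \<phi> k (c t))"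
        using lin[OF t] by (simp add: linear_iff inner_add_left)
      from linear_axis_expansion[OF this, of k]
      have "dir_deriv \<phi> k (c t) \<bullet> dir_deriv \<phi> k (c t)
          = (\<Sum>i\<in>UNIV. (e i t \<bullet> dir_deriv \<phi> k (c t)) * k $ i)" by (simp add: e_def)
      ultimately have "dir_deriv \<phi> k (c t) = 0" by simp
      then show "k = 0"
        using ch(3)[OF c(1)[OF t]] linear_injective_0[OF lin[OF t]] by blast
    qed
    then show ?thesis
      by (simp add: invertible_det_nz[symmetric] invertible_left_inverse matrix_left_invertible_ker)
  qed
  have e_diff: "e i differentiable (at t)" if "t \<in> T" for i t
    using has_vector_derivative_smooth_compose[OF smooth_on_dir_deriv[OF ch(2)] c(1)[OF that] v[OF that]]
    unfolding e_def by (rule differentiableI_vector)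
  have "v differentiable (at t)" if t: "t \<in> T" for t
  proof (rule differentiable_linear_system_solution[where A = G and b = "\<lambda>t. \<chi> i. e i t \<bullet> \<gamma>\<^sub>1 t", OF _ _ T t])
    show "(\<lambda>t. G t $ i $ j) differentiable (at t)" for i j
      unfolding G_def by (simp add: differentiable_inner e_diff[OF t])
    show "(\<lambda>t. (\<chi> i. e i t \<bullet> \<gamma>\<^sub>1 t) $ i) differentiable (at t)" for i
      using differentiableI_vector[OF \<gamma>(2)] by (simp add: differentiable_inner e_diff[OF t])
    show "G t *v v t = (\<chi> i. e i t \<bullet> \<gamma>\<^sub>1 t)" if "t \<in> T" for t
      by (simp add: vec_eq_iff G[OF that] \<gamma>\<^sub>1[OF that])
  qed (rule det)
  then have v': "(v has_vector_derivative vector_derivative v (at t)) (at t)" if "t \<in> T" for t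
    using that by (simp add: vector_derivative_works)
  show ?thesis
  proof (rule that)
    show "((\<lambda>s. inv_into U \<phi> (\<gamma> s)) has_vector_derivative v s) (at s)" if "\<gamma> s \<in> \<phi> ` U" for s
      using v that by (simp add: T_def c_def)
    show "(v has_vector_derivative vector_derivative v (at s)) (at s)" if "\<gamma> s \<in> \<phi> ` U" for s
      using v' that by (simp add: T_def)
  qed
qed

section \<open>Stereographic charts\<close>

lemma Ck_on_const: "Ck_on k U (\<lambda>x. c)"
  by (induction k arbitrary: c) auto

lemma Ck_on_Suc_imp: "Ck_on (Suc k) U f \<Longrightarrow> Ck_on k U f"
proof (induction k arbitrary: f)
  case 0
  then show ?case
    by (auto intro: continuous_at_imp_continuous_on differentiable_imp_continuous_within)
next
  case (Suc k)
  then show ?case by (metis Ck_on.simps(2))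
qed

lemma Ck_on_bounded_linear:
  assumes "bounded_linear f"
  shows "Ck_on k U f"
proof (cases k)
  case 0
  then show ?thesis
    using assms by (simp add: linear_continuous_on)
next
  case (Suc j)
  have "frechet_derivative f (at x) = f" for x
    using frechet_derivative_at[OF bounded_linear_imp_has_derivative[OF assms]] by simp
  then show ?thesis
    using Suc assms by (simp add: Ck_on_const bounded_linear_imp_differentiable)
qed

lemma Ck_on_add:
  assumes "Ck_on k UNIV f" "Ck_on k UNIV g"
  shows "Ck_on k UNIV (\<lambda>x. f x + g x)"
  using assms
proof (induction k arbitrary: f g)
  case 0
  then show ?case by (auto intro: continuous_on_add)
next
  case (Suc k)
  have D: "(f has_derivative frechet_derivative f (at x)) (at x)" "(g has_derivative frechet_derivative g (at x)) (at x)" for x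
    using Suc.prems by (auto simp: frechet_derivative_works[symmetric])
  have "frechet_derivative (\<lambda>x. f x + g x) (at x) v = frechet_derivative f (at x) v + frechet_derivative g (at x) v" for x v
    using frechet_derivative_at[OF has_derivative_add[OF D], symmetric] by simp
  then show ?case using Suc by (simp add: differentiable_add)
qed

lemma Ck_on_scaleR:
  fixes f :: "'a::euclidean_space \<Rightarrow> real" and g :: "'a \<Rightarrow> 'b::euclidean_space"
  assumes "Ck_on k UNIV f" "Ck_on k UNIV g"
  shows "Ck_on k UNIV (\<lambda>x. f x *\<^sub>R g x)"
  using assms
proof (induction k arbitrary: f g)
  case 0
  then show ?case by (auto intro: continuous_on_scaleR)
next
  case (Suc k)
  have D: "(f has_derivative frechet_derivative f (at x)) (at x)" "(g has_derivative frechet_derivative g (at x)) (at x)" for x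
    using Suc.prems by (auto simp: frechet_derivative_works[symmetric])
  have eq: "frechet_derivative (\<lambda>x. f x *\<^sub>R g x) (at x) v
      = f x *\<^sub>R frechet_derivative g (at x) v + frechet_derivative f (at x) v *\<^sub>R g x" for x v
    using frechet_derivative_at[OF has_derivative_scaleR[OF D], symmetric] by simp
  have "Ck_on k UNIV (\<lambda>x. f x *\<^sub>R frechet_derivative g (at x) v + frechet_derivative f (at x) v *\<^sub>R g x)" for v
    by (intro Ck_on_add Suc.IH) (use Suc.prems Ck_on_Suc_imp[OF Suc.prems(1)] Ck_on_Suc_imp[OF Suc.prems(2)] in auto)
  then show ?case using Suc.prems by (simp add: eq differentiable_scaleR)
qed

lemma one_plus_inner_pos: "1 + x \<bullet> x > (0 :: real)"
  by (simp add: add_pos_nonneg)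

text \<open>The derivative \<open>- 2 (v \<bullet> x) r\<^sup>2\<close> of \<open>r = 1 / (1 + x \<bullet> x)\<close> is again a product of \<open>r\<close>, \<open>r\<close> and a linear
  function, so the order of differentiability increases by one at each step.\<close>

lemma Ck_on_inverse_one_plus_inner:
  "Ck_on k UNIV (\<lambda>x :: 'a::euclidean_space. inverse (1 + x \<bullet> x))"
proof (induction k)
  case 0
  have "1 + x \<bullet> x \<noteq> (0 :: real)" for x :: 'a
    using one_plus_inner_pos[of x] by linarith
  then show ?case by (auto intro!: continuous_intros)
next
  case (Suc k)
  let ?r = "\<lambda>x :: 'a. inverse (1 + x \<bullet> x)"
  have D: "(?r has_derivative (\<lambda>v. (- 2 * (v \<bullet> x)) *\<^sub>R (?r x *\<^sub>R ?r x))) (at x)" for x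
    using one_plus_inner_pos[of x]
    by (auto intro!: derivative_eq_intros simp: inner_commute fun_eq_iff power2_eq_square divide_inverse)
  have lin: "bounded_linear (\<lambda>x. - 2 * (v \<bullet> x))" for v :: 'a
    by (intro bounded_linear_const_mult bounded_linear_inner_right)
  have "frechet_derivative ?r (at x) v = (- 2 * (v \<bullet> x)) *\<^sub>R (?r x *\<^sub>R ?r x)" for x v
    by (simp only: frechet_derivative_at[OF D, symmetric])
  moreover have "Ck_on k UNIV (\<lambda>x. (- 2 * (v \<bullet> x)) *\<^sub>R (?r x *\<^sub>R ?r x))" for v
    by (intro Ck_on_scaleR Suc Ck_on_bounded_linear[OF lin])
  moreover have "?r differentiable (at x)" for x
    using D unfolding differentiable_def by blast
  ultimately show ?case by (simp only: Ck_on.simps) simp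
qed

text \<open>With a linear isometry \<open>J\<close> onto the orthogonal complement of \<open>p\<close>, the inverse of the projection from
  \<open>p\<close> is \<open>(2 J u + (\<bar>u\<bar>\<^sup>2 - 1) p) / (1 + \<bar>u\<bar>\<^sup>2)\<close>, which is \<open>p + 2 r (J u - p)\<close> for \<open>r = 1 / (1 + \<bar>u\<bar>\<^sup>2)\<close>. The
  projection \<open>\<psi>\<close> is a differentiable left inverse, which yields both injectivity of the derivative
  and continuity of the inverse.\<close>

lemma stereographic_chart:
  fixes p :: "real ^ ('n::finite + 1)"
  assumes p: "norm p = 1"
  obtains \<phi> :: "real ^ 'n \<Rightarrow> real ^ ('n + 1)" where "sphere_chart UNIV \<phi>" "range \<phi> = sphere 0 1 - {p}"
proof -
  have "p \<noteq> 0" using p by auto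
  have pp: "p \<bullet> p = 1" using p by (simp add: dot_square_norm)
  obtain J :: "real ^ 'n \<Rightarrow> real ^ ('n + 1)" where J: "linear J" "range J \<subseteq> tangent_sphere p" "\<And>u. norm (J u) = norm u"
  proof (rule isometry_subset_subspace[OF subspace_UNIV subspace_tangent_sphere])
    show "dim (UNIV :: (real ^ 'n) set) \<le> dim (tangent_sphere p)"
      by (simp add: dim_tangent_sphere[OF \<open>p \<noteq> 0\<close>])
  qed (auto simp: Pi_iff)
  have "inj J"
    using J(1,3) by (simp add: linear_injective_0) (metis norm_eq_zero)
  have rangeJ: "range J = tangent_sphere p"
    using dim_image_eq[OF J(1), of UNIV] \<open>inj J\<close> dim_tangent_sphere[OF \<open>p \<noteq> 0\<close>] J(2)
    by (intro subspace_dim_equal linear_subspace_image[OF J(1)] subspace_tangent_sphere) auto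
  have pJ: "p \<bullet> J u = 0" for u using J(2) by (auto simp: tangent_sphere_def)
  have JJ: "J u \<bullet> J k = u \<bullet> k" for u k
    using J(3)[of "u + k"] J(3)[of u] J(3)[of k] by (simp add: dot_norm linear_add[OF J(1)])
  define J' where "J' = adjoint J"
  have J': "linear J'" "J' p = 0" "J' (J u) = u" for u
  proof -
    show "linear J'" unfolding J'_def by (rule adjoint_linear[OF J(1)])
    have "J' p \<bullet> k = 0 \<bullet> k" for k unfolding J'_def by (simp add: adjoint_clauses(2)[OF J(1)] pJ)
    then show "J' p = 0" using vector_eq_rdot by blast
    have "J' (J u) \<bullet> k = u \<bullet> k" for k unfolding J'_def by (simp add: adjoint_clauses(2)[OF J(1)] JJ)
    then show "J' (J u) = u" using vector_eq_rdot by blast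
  qed
  define r where "r = (\<lambda>u :: real ^ 'n. inverse (1 + u \<bullet> u))"
  have r: "r u > 0" "r u * (1 + u \<bullet> u) = 1" for u
    using one_plus_inner_pos[of u] by (simp_all add: r_def)
  define \<phi> where "\<phi> = (\<lambda>u. p + (2 * r u) *\<^sub>R (J u - p))"
  define \<psi> where "\<psi> = (\<lambda>x. J' (inverse (1 - x \<bullet> p) *\<^sub>R x))"
  have \<phi>p: "1 - \<phi> u \<bullet> p = 2 * r u" for u
    using pJ[of u] pp by (simp add: \<phi>_def inner_add_left inner_diff_left inner_commute[of "J u" p])
  have \<psi>\<phi>: "\<psi> (\<phi> u) = u" for u
  proof -
    have "J' (\<phi> u) = (2 * r u) *\<^sub>R u"
      by (simp add: \<phi>_def linear_add[OF J'(1)] linear_scale[OF J'(1)] linear_diff[OF J'(1)] J')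
    then show ?thesis
      using r(1)[of u] by (simp add: \<psi>_def \<phi>p linear_scale[OF J'(1)])
  qed
  have \<phi>_sphere: "norm (\<phi> u) = 1" for u
  proof -
    have q: "p \<bullet> (J u - p) = - 1" "(J u - p) \<bullet> (J u - p) = 1 + u \<bullet> u"
      using pJ[of u] JJ[of u u] pp by (simp_all add: inner_diff inner_commute[of "J u" p])
    have "\<phi> u \<bullet> \<phi> u = p \<bullet> p + 4 * r u * (p \<bullet> (J u - p)) + 4 * r u * r u * ((J u - p) \<bullet> (J u - p))"
      unfolding \<phi>_def inner_add_left inner_add_right inner_scaleR_left inner_scaleR_right
        inner_commute[of "J u - p" p]
      by (simp only: algebra_simps)
    also have "\<dots> = 1 - 4 * r u + 4 * r u * (r u * (1 + u \<bullet> u))"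
      unfolding q pp by simp
    finally have "\<phi> u \<bullet> \<phi> u = 1 - 4 * r u + 4 * r u * (r u * (1 + u \<bullet> u))" .
    then show ?thesis by (simp add: r(2) norm_eq_1)
  qed
  have onto: "\<phi> (\<psi> x) = x" if x: "norm x = 1" "x \<noteq> p" for x
  proof -
    define a where "a = x \<bullet> p"
    have xx: "x \<bullet> x = 1" using x by (simp add: dot_square_norm)
    have "(x - p) \<bullet> (x - p) = 2 * (1 - a)"
      using xx pp by (simp add: inner_diff a_def inner_commute)
    moreover have "(x - p) \<bullet> (x - p) > 0" using x by (simp add: inner_gt_zero_iff)
    ultimately have a: "1 - a > 0" by simp
    have "x - a *\<^sub>R p \<in> range J"
      unfolding rangeJ by (simp add: tangent_sphere_def inner_diff_right pp a_def inner_commute)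
    then obtain h where h: "x - a *\<^sub>R p = J h" by auto
    then have xh: "x = J h + a *\<^sub>R p" by (simp add: algebra_simps)
    have hh: "h \<bullet> h = 1 - a * a"
      using xx JJ[of h h] pJ[of h] pp unfolding xh by (simp add: inner_add inner_commute[of "J h" p])
    have \<psi>x: "\<psi> x = inverse (1 - a) *\<^sub>R h"
      unfolding \<psi>_def a_def[symmetric]
      by (simp add: linear_scale[OF J'(1)]) (simp add: xh linear_add[OF J'(1)] linear_scale[OF J'(1)] J')
    have "1 + \<psi> x \<bullet> \<psi> x = 2 / (1 - a)"
      using a by (simp add: \<psi>x hh divide_simps) (simp add: algebra_simps)
    then have "2 * r (\<psi> x) = 1 - a" by (simp add: r_def)
    then have "\<phi> (\<psi> x) = p + (1 - a) *\<^sub>R (inverse (1 - a) *\<^sub>R J h - p)"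
      by (simp only: \<phi>_def) (simp only: \<psi>x linear_scale[OF J(1)])
    also have "\<dots> = J h + a *\<^sub>R p" using a by (simp add: scaleR_diff_right scaleR_diff_left)
    finally show ?thesis using xh by simp
  qed
  have range: "range \<phi> = sphere 0 1 - {p}"
  proof
    show "range \<phi> \<subseteq> sphere 0 1 - {p}"
    proof
      fix x assume "x \<in> range \<phi>"
      then obtain u where x: "x = \<phi> u" by auto
      have "x \<noteq> p" using \<phi>p[of u] r(1)[of u] pp x by auto
      then show "x \<in> sphere 0 1 - {p}" by (simp add: x \<phi>_sphere)
    qed
    show "sphere 0 1 - {p} \<subseteq> range \<phi>"
    proof
      fix x assume "x \<in> sphere 0 1 - {p}"
      then have "\<phi> (\<psi> x) = x" by (intro onto) auto
      then show "x \<in> range \<phi>" by (metis rangeI)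
    qed
  qed
  have smooth: "smooth_on UNIV \<phi>"
    unfolding smooth_on_def
  proof
    fix k
    have "Ck_on k UNIV (\<lambda>u. p + (2 *\<^sub>R r u) *\<^sub>R (J u + - p))"
      unfolding r_def
      by (intro Ck_on_add Ck_on_const Ck_on_scaleR Ck_on_inverse_one_plus_inner
          Ck_on_bounded_linear linear_conv_bounded_linear[THEN iffD1] J(1))
    then show "Ck_on k UNIV \<phi>" by (simp add: \<phi>_def)
  qed
  have \<psi>_diff: "\<psi> differentiable (at (\<phi> u))" for u
  proof -
    have "(\<lambda>x. inverse (1 - x \<bullet> p) *\<^sub>R x) differentiable (at (\<phi> u))"
      using \<phi>p[of u] r(1)[of u] by (intro differentiable_scaleR differentiable_inverse differentiable_diff
          differentiable_const differentiable_inner differentiable_ident) auto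
    then show ?thesis
      unfolding \<psi>_def differentiable_def
      using bounded_linear.has_derivative J'(1) linear_conv_bounded_linear by blast
  qed
  have "sphere_chart UNIV \<phi>"
    unfolding sphere_chart_def
  proof (intro conjI ballI)
    show "inj (frechet_derivative \<phi> (at u))" for u
    proof -
      have "((\<lambda>u. \<psi> (\<phi> u)) has_derivative (\<lambda>h. frechet_derivative \<psi> (at (\<phi> u)) (frechet_derivative \<phi> (at u) h))) (at u)"
        using has_derivative_compose[OF smooth_on_has_derivative[OF smooth, of u]
            \<psi>_diff[of u, unfolded frechet_derivative_works]] by simp
      then have "(\<lambda>h. frechet_derivative \<psi> (at (\<phi> u)) (frechet_derivative \<phi> (at u) h)) = (\<lambda>h. h)"
        unfolding \<psi>\<phi> by (rule has_derivative_unique[OF _ has_derivative_ident])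
      then show ?thesis by (metis injI)
    qed
    have inv: "inv_into UNIV \<phi> x = \<psi> x" if "x \<in> range \<phi>" for x
    proof -
      have "inj \<phi>" by (rule inj_on_inverseI[of _ \<psi>]) (rule \<psi>\<phi>)
      then show ?thesis using that \<psi>\<phi> by auto
    qed
    have "continuous_on (range \<phi>) \<psi>"
      using \<psi>_diff by (auto intro!: continuous_at_imp_continuous_on differentiable_imp_continuous_within)
    then have "continuous_on (range \<phi>) (inv_into UNIV \<phi>)"
      by (rule continuous_on_eq) (simp add: inv)
    moreover have "continuous_on UNIV \<phi>"
      using smooth unfolding smooth_on_def by (metis Ck_on.simps(1))
    ultimately show "homeomorphism UNIV (range \<phi>) \<phi> (inv_into UNIV \<phi>)"
      unfolding homeomorphism_def using inv \<psi>\<phi> by (auto simp: image_iff) metis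
    show "openin (top_of_set (sphere 0 1)) (range \<phi>)"
      unfolding range by (rule openin_delete) simp
  qed (use smooth in auto)
  then show ?thesis using that range by blast
qed

section \<open>The matrix exponential\<close>

lemma matrix_exp_scaleR_eq:
  fixes Q :: "real ^ 'm::finite ^ 'm"
  shows "matrix_exp (s *\<^sub>R Q) = (\<Sum>k. (s ^ k / fact k) *\<^sub>R (((**) Q) ^^ k) (mat 1))"
proof -
  have "(((**) (s *\<^sub>R Q)) ^^ k) (mat 1) = s ^ k *\<^sub>R (((**) Q) ^^ k) (mat 1)" for k
    by (induction k)
       (simp_all add: vec_eq_iff matrix_matrix_mult_def sum_distrib_left algebra_simps)
  then show ?thesis by (simp add: matrix_exp_def)
qed

lemma bounded_linear_matrix_mult_left:
  fixes Q :: "real ^ 'm::finite ^ 'm"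
  shows "bounded_linear ((**) Q :: real ^ 'm ^ 'm \<Rightarrow> _)"
  unfolding linear_conv_bounded_linear[symmetric]
  by (rule linearI) (simp_all add: vec_eq_iff matrix_matrix_mult_def sum.distrib sum_distrib_left algebra_simps)

lemma summable_matrix_exp:
  fixes Q :: "real ^ 'm::finite ^ 'm"
  shows "summable (\<lambda>k. (s ^ k / fact k) *\<^sub>R (((**) Q) ^^ k) (mat 1))"
proof -
  obtain K where K: "K > 0" "\<And>A :: real ^ 'm ^ 'm. norm (Q ** A) \<le> norm A * K"
    using bounded_linear.pos_bounded[OF bounded_linear_matrix_mult_left[of Q]] by blast
  have bound: "norm ((((**) Q) ^^ k) (mat 1)) \<le> norm (mat 1 :: real ^ 'm ^ 'm) * K ^ k" for k
  proof (induction k)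
    case (Suc k)
    have "norm ((((**) Q) ^^ Suc k) (mat 1)) \<le> norm ((((**) Q) ^^ k) (mat 1)) * K"
      using K(2) by simp
    also have "\<dots> \<le> (norm (mat 1 :: real ^ 'm ^ 'm) * K ^ k) * K"
      using Suc K(1) by (intro mult_right_mono) auto
    finally show ?case by (simp add: mult.commute mult.left_commute)
  qed simp
  have "summable (\<lambda>k. norm (mat 1 :: real ^ 'm ^ 'm) * (inverse (fact k) * (\<bar>s\<bar> * K) ^ k))"
    by (intro summable_mult summable_exp)
  then show ?thesis
  proof (rule summable_comparison_test'[where N = 0])
    fix k
    have "norm ((s ^ k / fact k) *\<^sub>R (((**) Q) ^^ k) (mat 1))
        = \<bar>s\<bar> ^ k / fact k * norm ((((**) Q) ^^ k) (mat 1))"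
      by (simp add: power_abs)
    also have "\<dots> \<le> \<bar>s\<bar> ^ k / fact k * (norm (mat 1 :: real ^ 'm ^ 'm) * K ^ k)"
      by (intro mult_left_mono bound) auto
    finally show "norm ((s ^ k / fact k) *\<^sub>R (((**) Q) ^^ k) (mat 1))
        \<le> norm (mat 1 :: real ^ 'm ^ 'm) * (inverse (fact k) * (\<bar>s\<bar> * K) ^ k)"
      by (simp add: power_mult_distrib field_simps)
  qed
qed

lemma matrix_exp_0: "matrix_exp (0 *\<^sub>R Q) = (mat 1 :: real ^ 'm::finite ^ 'm)"
proof -
  have "(\<lambda>k. (0 ^ k / fact k) *\<^sub>R (((**) Q) ^^ k) (mat 1)) sums ((0 ^ 0 / fact 0) *\<^sub>R (((**) Q) ^^ 0) (mat 1 :: real ^ 'm ^ 'm))"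
    using sums_finite[of "{0}" "\<lambda>k. (0 ^ k / fact k) *\<^sub>R (((**) Q) ^^ k) (mat 1 :: real ^ 'm ^ 'm)"] by simp
  then show ?thesis unfolding matrix_exp_scaleR_eq by (simp add: sums_iff)
qed

text \<open>Every coordinate is a power series in \<open>s\<close> that converges everywhere, so it is differentiated
  term by term.\<close>

lemma has_vector_derivative_matrix_exp:
  fixes Q :: "real ^ 'm::finite ^ 'm"
  shows "((\<lambda>s. matrix_exp (s *\<^sub>R Q)) has_vector_derivative Q ** matrix_exp (s *\<^sub>R Q)) (at s)"
  unfolding has_vector_derivative_def
proof (rule iffD2[OF has_derivative_componentwise_within], rule)
  fix b :: "real ^ 'm ^ 'm"
  define P where "P = (\<lambda>k. (((**) Q) ^^ k) (mat 1 :: real ^ 'm ^ 'm))"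
  define a where "a = (\<lambda>k. (P k \<bullet> b) / fact k)"
  note bl = bounded_linear_inner_left[of b]
  have coord: "(\<lambda>k. a k * s ^ k) sums (matrix_exp (s *\<^sub>R Q) \<bullet> b)" for s
    using bounded_linear.sums[OF bl summable_sums[OF summable_matrix_exp[of s Q]]]
    by (simp add: matrix_exp_scaleR_eq a_def P_def mult.commute)
  have diffs: "diffs a k = (P (Suc k) \<bullet> b) / fact k" for k
    by (simp add: diffs_def a_def field_simps del: of_nat_Suc)
  have "(\<lambda>k. diffs a k * s ^ k) sums ((Q ** matrix_exp (s *\<^sub>R Q)) \<bullet> b)"
    using bounded_linear.sums[OF bl bounded_linear.sums[OF bounded_linear_matrix_mult_left
          summable_sums[OF summable_matrix_exp[of s Q]], of Q]]
    by (simp add: matrix_exp_scaleR_eq diffs P_def mult.commute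
        linear_scale[OF bounded_linear.linear[OF bounded_linear_matrix_mult_left]])
  moreover have "((\<lambda>s. \<Sum>k. a k * s ^ k) has_real_derivative (\<Sum>k. diffs a k * s ^ k)) (at s)"
    using coord by (intro termdiffs_strong_converges_everywhere) (auto simp: sums_iff)
  ultimately have "((\<lambda>s. matrix_exp (s *\<^sub>R Q) \<bullet> b) has_real_derivative ((Q ** matrix_exp (s *\<^sub>R Q)) \<bullet> b)) (at s)"
    using coord by (simp add: sums_iff)
  then show "((\<lambda>s. matrix_exp (s *\<^sub>R Q) \<bullet> b) has_derivative (\<lambda>h. (h *\<^sub>R (Q ** matrix_exp (s *\<^sub>R Q))) \<bullet> b)) (at s)"
    by (simp add: has_field_derivative_def mult_commute_abs)
qed

lemma has_vector_derivative_matrix_exp_mult: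
  fixes Q :: "real ^ 'm::finite ^ 'm"
  assumes "(f has_vector_derivative f') (at s)"
  shows "((\<lambda>s. matrix_exp (s *\<^sub>R Q) *v f s) has_vector_derivative
    Q *v (matrix_exp (s *\<^sub>R Q) *v f s) + matrix_exp (s *\<^sub>R Q) *v f') (at s)"
proof -
  have "bounded_bilinear (\<lambda>(A :: real ^ 'm ^ 'm) v. A *v v)"
    by (rule bilinear_conv_bounded_bilinear[THEN iffD1])
       (auto simp: bilinear_def linear_iff matrix_vector_mult_add_rdistrib matrix_vector_right_distrib
          matrix_vector_mult_scaleR scaleR_matrix_vector_assoc)
  from bounded_bilinear.has_vector_derivative[OF this has_vector_derivative_matrix_exp[of Q] assms]
  show ?thesis by (simp add: matrix_vector_mul_assoc add.commute)
qed

section \<open>Unit speed geodesics of the navigation metric\<close>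

text \<open>The squared norm of a solution of \<open>f' = Q f\<close> has derivative \<open>2 f \<bullet> Q f = 0\<close>.\<close>

lemma norm_matrix_exp_skew:
  fixes Q :: "real ^ 'm::finite ^ 'm"
  assumes "transpose Q = - Q"
  shows "norm (matrix_exp (s *\<^sub>R Q) *v x) = norm x"
proof -
  define f where "f = (\<lambda>s. matrix_exp (s *\<^sub>R Q) *v x)"
  have f: "(f has_vector_derivative Q *v f s) (at s)" for s
    using has_vector_derivative_matrix_exp_mult[OF has_vector_derivative_const, of Q x s] by (simp add: f_def)
  have "((\<lambda>s. f s \<bullet> f s) has_real_derivative 0) (at s)" for s
    using has_real_derivative_inner[OF f f, of s]
    by (simp add: inner_skew_matrix(2)[OF assms] inner_commute[of "Q *v f s"])
  then have "f s \<bullet> f s = f 0 \<bullet> f 0" by (intro DERIV_isconst_all) auto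
  then show ?thesis using matrix_exp_0[of Q] by (simp add: f_def norm_eq_sqrt_inner)
qed

text \<open>The difference \<open>(d, e)\<close> of two solutions solves the same system, and \<open>\<bar>d\<bar>\<^sup>2 + \<bar>e\<bar>\<^sup>2\<close> is constant: the
  terms with \<open>Q\<close> vanish by skewness and the coupling terms cancel.\<close>

lemma skew_oscillator_unique:
  fixes Q :: "real ^ 'm::finite ^ 'm"
  assumes Q: "transpose Q = - Q"
    and f: "\<And>s. (f has_vector_derivative Q *v f s + g s) (at s)" "\<And>s. (g has_vector_derivative Q *v g s - f s) (at s)"
    and f': "\<And>s. (f' has_vector_derivative Q *v f' s + g' s) (at s)" "\<And>s. (g' has_vector_derivative Q *v g' s - f' s) (at s)"
    and init: "f 0 = f' 0" "g 0 = g' 0"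
  shows "f s = f' s"
proof -
  define d e where "d = (\<lambda>s. f s - f' s)" and "e = (\<lambda>s. g s - g' s)"
  have d: "(d has_vector_derivative Q *v d s + e s) (at s)" for s
    using has_vector_derivative_diff[OF f(1)[of s] f'(1)[of s]]
    by (simp add: d_def e_def algebra_simps)
  have e: "(e has_vector_derivative Q *v e s - d s) (at s)" for s
    using has_vector_derivative_diff[OF f(2)[of s] f'(2)[of s]]
    by (simp add: d_def e_def algebra_simps)
  have "((\<lambda>s. d s \<bullet> d s + e s \<bullet> e s) has_real_derivative 0) (at s)" for s
  proof -
    have "d s \<bullet> (Q *v d s + e s) + (Q *v d s + e s) \<bullet> d s + (e s \<bullet> (Q *v e s - d s) + (Q *v e s - d s) \<bullet> e s) = 0"
      by (simp add: inner_add_right inner_add_left inner_diff_right inner_diff_left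
          inner_skew_matrix(2)[OF Q] inner_commute[of "Q *v d s"] inner_commute[of "Q *v e s"] inner_commute[of "e s" "d s"])
    then show ?thesis
      using DERIV_add[OF has_real_derivative_inner[OF d d] has_real_derivative_inner[OF e e], of s] by simp
  qed
  then have "d s \<bullet> d s + e s \<bullet> e s = d 0 \<bullet> d 0 + e 0 \<bullet> e 0" by (intro DERIV_isconst_all) auto
  also have "\<dots> = 0" using init by (simp add: d_def e_def)
  finally have "d s \<bullet> d s = 0"
    using inner_ge_zero[of "d s"] inner_ge_zero[of "e s"] by linarith
  then show ?thesis by (simp add: d_def)
qed

lemma navigation_metric_eq_1_iff:
  assumes "norm (V x) < 1"
  shows "navigation_metric V x y = 1 \<longleftrightarrow> norm (y - V x) = 1"
proof
  assume 1: "navigation_metric V x y = 1"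
  then have "y \<noteq> 0" by (auto simp: navigation_metric_def)
  from nav_norm_solves(2)[OF assms this] show "norm (y - V x) = 1"
    using 1 navigation_metric_eq_nav_norm[of V x y] assms \<open>y \<noteq> 0\<close> by (simp add: relative_velocity_def)
next
  assume "norm (y - V x) = 1"
  from nav_norm_unit[OF assms this] show "navigation_metric V x y = 1"
    using navigation_metric_eq_nav_norm[of V x y] assms by simp
qed

text \<open>By the product rule, the flow of \<open>Q\<close> carries the harmonic oscillator \<open>f' = g\<close>, \<open>g' = - f\<close> to the
  system solved by geodesics, and it preserves norms.\<close>

lemma skew_flow_of_great_circle:
  fixes Q :: "real ^ 'm::finite ^ 'm" and x b :: "real ^ 'm"
  assumes Q: "transpose Q = - Q"
    and \<gamma>_def: "\<gamma> = (\<lambda>s. matrix_exp (s *\<^sub>R Q) *v (cos s *\<^sub>R x + sin s *\<^sub>R b))"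
    and w_def: "w = (\<lambda>s. matrix_exp (s *\<^sub>R Q) *v (cos s *\<^sub>R b - sin s *\<^sub>R x))"
  shows "(\<gamma> has_vector_derivative Q *v \<gamma> s + w s) (at s)" "(w has_vector_derivative Q *v w s - \<gamma> s) (at s)"
    "\<gamma> 0 = x" "w 0 = b"
    "norm x = 1 \<Longrightarrow> norm b = 1 \<Longrightarrow> x \<bullet> b = 0 \<Longrightarrow> norm (\<gamma> s) = 1"
    "norm x = 1 \<Longrightarrow> norm b = 1 \<Longrightarrow> x \<bullet> b = 0 \<Longrightarrow> norm (w s) = 1"
proof -
  note D = has_vector_derivative_matrix_exp_mult[where Q = Q]
  have p: "((\<lambda>s. cos s *\<^sub>R x + sin s *\<^sub>R b) has_vector_derivative (cos s *\<^sub>R b - sin s *\<^sub>R x)) (at s)"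
    by (auto intro!: derivative_eq_intros simp: has_vector_derivative_def algebra_simps)
  have q: "((\<lambda>s. cos s *\<^sub>R b - sin s *\<^sub>R x) has_vector_derivative (- (cos s *\<^sub>R x + sin s *\<^sub>R b))) (at s)"
    by (auto intro!: derivative_eq_intros simp: has_vector_derivative_def algebra_simps)
  show "(\<gamma> has_vector_derivative Q *v \<gamma> s + w s) (at s)"
    using D[OF p] by (simp add: \<gamma>_def w_def)
  have neg: "A *v (- v) = - (A *v v)" for A :: "real ^ 'm ^ 'm" and v
    using matrix_vector_mult_scaleR[of A "- 1" v] by simp
  show "(w has_vector_derivative Q *v w s - \<gamma> s) (at s)"
    using D[OF q] by (simp only: \<gamma>_def w_def neg) simp
  show "\<gamma> 0 = x" "w 0 = b" using matrix_exp_0[of Q] by (simp_all add: \<gamma>_def w_def)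
  assume n: "norm x = 1" "norm b = 1" and o: "x \<bullet> b = 0"
  have xx: "x \<bullet> x = 1" "b \<bullet> b = 1" "b \<bullet> x = 0" using n o by (simp_all add: dot_square_norm inner_commute)
  have cs: "cos s * cos s + sin s * sin s = 1" "sin s * sin s + cos s * cos s = 1"
    using sin_cos_squared_add[of s] by (simp_all add: power2_eq_square)
  show "norm (\<gamma> s) = 1" "norm (w s) = 1"
    unfolding \<gamma>_def w_def norm_matrix_exp_skew[OF Q] norm_eq_1
    by (simp_all add: inner_add_left inner_add_right inner_diff_left inner_diff_right xx o cs)
qed

lemma sphere_chart_exists:
  fixes x :: "real ^ ('n::finite + 1)"
  assumes "norm x = 1"
  obtains U :: "(real ^ 'n) set" and \<phi> where "sphere_chart U \<phi>" "x \<in> \<phi> ` U"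
proof -
  obtain \<phi> :: "real ^ 'n \<Rightarrow> real ^ ('n + 1)" where \<phi>: "sphere_chart UNIV \<phi>" "range \<phi> = sphere 0 1 - {- x}"
    using stereographic_chart[of "- x"] assms by auto
  have "x \<bullet> x = 1" using assms by (simp add: dot_square_norm)
  then have "x \<noteq> - x" by (metis inner_minus_left neg_equal_zero zero_neq_one)
  then have "x \<in> range \<phi>" using \<phi>(2) assms by simp
  then show ?thesis using that \<phi>(1) by blast
qed

text \<open>A chart around \<open>\<gamma> s\<close> supplies the second derivative of \<open>\<gamma>\<close> at \<open>s\<close> as well as its value.\<close>

lemma geodesic_acceleration:
  fixes Q :: "real ^ ('n::finite + 1) ^ ('n + 1)" and \<gamma> :: "real \<Rightarrow> real ^ ('n + 1)"
  assumes Q: "transpose Q = - Q" "positive_definite (mat 1 + Q ** Q)"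
    and geo: "sphere_geodesic (navigation_metric (\<lambda>p. Q *v p)) \<gamma>"
    and \<gamma>: "\<And>t. (\<gamma> has_vector_derivative \<gamma>\<^sub>1 t) (at t)"
    and unit: "\<And>t. norm (\<gamma>\<^sub>1 t - Q *v \<gamma> t) = 1"
  shows "(\<gamma>\<^sub>1 has_vector_derivative Q *v \<gamma>\<^sub>1 s + Q *v (\<gamma>\<^sub>1 s - Q *v \<gamma> s) - \<gamma> s) (at s)"
proof -
  have cont: "continuous_on UNIV \<gamma>" and sphere: "range \<gamma> \<subseteq> sphere 0 1"
    using geo unfolding sphere_geodesic_def by auto
  have "\<gamma> s \<in> sphere 0 1" using sphere by (rule subsetD) simp
  then obtain U :: "(real ^ 'n) set" and \<phi> where chart: "sphere_chart U \<phi>" and s: "\<gamma> s \<in> \<phi> ` U"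
    using sphere_chart_exists[of "\<gamma> s"] by auto
  note ch = sphere_chartD[OF chart]
  define c where "c = (\<lambda>s. inv_into U \<phi> (\<gamma> s))"
  define T where "T = {t. \<gamma> t \<in> \<phi> ` U}"
  have T: "open T" "s \<in> T"
    unfolding T_def using open_chart_times[OF chart cont sphere] s by auto
  obtain v a where va: "\<And>t. t \<in> T \<Longrightarrow> (c has_vector_derivative v t) (at t)"
      "\<And>t. t \<in> T \<Longrightarrow> (v has_vector_derivative a t) (at t)"
      "\<And>t i. t \<in> T \<Longrightarrow> a t $ i + 2 * spray_coeff (chart_metric (navigation_metric (\<lambda>p. Q *v p)) \<phi>) (c t) (v t) $ i = 0"
  proof -
    from geo[unfolded sphere_geodesic_def Let_def, THEN conjunct2, THEN conjunct2, rule_format, OF chart]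
    obtain v a where "\<forall>t. \<gamma> t \<in> \<phi> ` U \<longrightarrow> (c has_vector_derivative v t) (at t) \<and>
        (v has_vector_derivative a t) (at t) \<and>
        (\<forall>i. a t $ i + 2 * spray_coeff (chart_metric (navigation_metric (\<lambda>p. Q *v p)) \<phi>) (c t) (v t) $ i = 0)"
      unfolding c_def by (elim exE)
    then show ?thesis by (intro that[of v a]) (simp_all add: T_def)
  qed
  have c: "c t \<in> U" "\<phi> (c t) = \<gamma> t" if "t \<in> T" for t
    using that unfolding c_def T_def by (auto intro: inv_into_into f_inv_into_f)
  have \<gamma>\<^sub>1: "\<gamma>\<^sub>1 t = dir_deriv \<phi> (v t) (c t)" if "t \<in> T" for t
  proof (rule vector_derivative_unique_at)
    show "(\<gamma> has_vector_derivative \<gamma>\<^sub>1 t) (at t)" by (rule \<gamma>)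
    show "(\<gamma> has_vector_derivative dir_deriv \<phi> (v t) (c t)) (at t)"
      by (rule has_vector_derivative_transform_within_open[OF
            has_vector_derivative_smooth_compose[OF ch(2) c(1)[OF that] va(1)[OF that]] T(1) that])
        (simp add: c)
  qed
  define \<gamma>\<^sub>2 where "\<gamma>\<^sub>2 = dir_deriv (dir_deriv \<phi> (v s)) (v s) (c s) + dir_deriv \<phi> (a s) (c s)"
  have \<gamma>\<^sub>2: "(\<gamma>\<^sub>1 has_vector_derivative \<gamma>\<^sub>2) (at s)"
    unfolding \<gamma>\<^sub>2_def
    by (rule has_vector_derivative_transform_within_open[OF
        has_vector_derivative_smooth_compose2[OF ch(1,2) c(1)[OF T(2)] va(1)[OF T(2)] va(2)[OF T(2)]] T])
      (simp add: \<gamma>\<^sub>1)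
  have "\<gamma>\<^sub>2 = Q *v \<gamma>\<^sub>1 s + Q *v (\<gamma>\<^sub>1 s - Q *v \<gamma> s) - \<gamma> s"
    by (rule iffD1[OF spray_iff_acceleration[OF Q chart T c(1) c(2)[symmetric] va(1) va(2)[OF T(2)] \<gamma> \<gamma>\<^sub>2 unit]])
       (use va(3)[OF T(2)] in auto)
  then show ?thesis using \<gamma>\<^sub>2 by simp
qed

lemma geodesic_if_acceleration:
  fixes Q :: "real ^ ('n::finite + 1) ^ ('n + 1)" and \<gamma> :: "real \<Rightarrow> real ^ ('n + 1)"
  assumes Q: "transpose Q = - Q" "positive_definite (mat 1 + Q ** Q)"
    and sphere: "\<And>t. norm (\<gamma> t) = 1"
    and \<gamma>: "\<And>t. (\<gamma> has_vector_derivative \<gamma>\<^sub>1 t) (at t)"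
      "\<And>t. (\<gamma>\<^sub>1 has_vector_derivative Q *v \<gamma>\<^sub>1 t + Q *v (\<gamma>\<^sub>1 t - Q *v \<gamma> t) - \<gamma> t) (at t)"
    and unit: "\<And>t. norm (\<gamma>\<^sub>1 t - Q *v \<gamma> t) = 1"
  shows "sphere_geodesic (navigation_metric (\<lambda>p. Q *v p)) \<gamma>"
  unfolding sphere_geodesic_def Let_def
proof (intro conjI allI impI)
  show cont: "continuous_on UNIV \<gamma>"
    using \<gamma>(1) by (meson continuous_at_imp_continuous_on has_vector_derivative_continuous)
  show range: "range \<gamma> \<subseteq> sphere 0 1" using sphere by auto
  fix U :: "(real ^ 'n) set" and \<phi> :: "real ^ 'n \<Rightarrow> real ^ ('n + 1)"
  assume chart: "sphere_chart U \<phi>"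
  define c where "c = (\<lambda>s. inv_into U \<phi> (\<gamma> s))"
  define T where "T = {t. \<gamma> t \<in> \<phi> ` U}"
  have T: "open T" unfolding T_def by (rule open_chart_times[OF chart cont range])
  obtain v a where va: "\<And>t. t \<in> T \<Longrightarrow> (c has_vector_derivative v t) (at t)"
      "\<And>t. t \<in> T \<Longrightarrow> (v has_vector_derivative a t) (at t)"
  proof (rule chart_coordinates_twice_differentiable[OF chart \<gamma> range])
    fix v a
    assume "\<And>s. \<gamma> s \<in> \<phi> ` U \<Longrightarrow> ((\<lambda>s. inv_into U \<phi> (\<gamma> s)) has_vector_derivative v s) (at s)"
      "\<And>s. \<gamma> s \<in> \<phi> ` U \<Longrightarrow> (v has_vector_derivative a s) (at s)"
    then show thesis by (intro that[of v a]) (simp_all add: c_def T_def)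
  qed
  have c: "c t \<in> U" "\<phi> (c t) = \<gamma> t" if "t \<in> T" for t
    using that unfolding c_def T_def by (auto intro: inv_into_into f_inv_into_f)
  have "\<forall>i. a s $ i + 2 * spray_coeff (chart_metric (navigation_metric (\<lambda>p. Q *v p)) \<phi>) (c s) (v s) $ i = 0"
    if s: "s \<in> T" for s
    by (rule iffD2[OF spray_iff_acceleration[OF Q chart T s c(1) c(2)[symmetric] va(1) va(2)[OF s] \<gamma>(1) \<gamma>(2) unit]])
       auto
  then show "\<exists>v a. \<forall>s. \<gamma> s \<in> \<phi> ` U \<longrightarrow>
      ((\<lambda>s. inv_into U \<phi> (\<gamma> s)) has_vector_derivative v s) (at s) \<and>
      (v has_vector_derivative a s) (at s) \<and>
      (\<forall>i. a s $ i + 2 * spray_coeff (chart_metric (navigation_metric (\<lambda>p. Q *v p)) \<phi>) (inv_into U \<phi> (\<gamma> s)) (v s) $ i = 0)"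
    using va unfolding T_def c_def by (intro exI[of _ v] exI[of _ a]) auto
qed

theorem theorem3p3:
  fixes Q :: "real ^ ('n::finite + 1) ^ ('n + 1)"
    and x X :: "real ^ ('n + 1)"
    and V :: "real ^ ('n + 1) \<Rightarrow> real ^ ('n + 1)"
    and F\<^sub>Q :: "real ^ ('n + 1) \<Rightarrow> real ^ ('n + 1) \<Rightarrow> real"
    and \<gamma> :: "real \<Rightarrow> real ^ ('n + 1)"
  assumes "transpose Q = - Q"
    and "positive_definite (mat 1 + Q ** Q)"
  defines "V \<equiv> (\<lambda>p. Q *v p)"
  defines "F\<^sub>Q \<equiv> navigation_metric V"
  assumes "x \<in> sphere 0 1"
    and "X \<in> tangent_sphere x"
    and "F\<^sub>Q x X = 1"
  shows "sphere_geodesic F\<^sub>Q \<gamma> \<and> unit_speed F\<^sub>Q \<gamma> \<and>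
           \<gamma> 0 = x \<and> (\<gamma> has_vector_derivative X) (at 0) \<longleftrightarrow>
         (\<forall>s. \<gamma> s = matrix_exp (s *\<^sub>R Q) *v (cos s *\<^sub>R x + sin s *\<^sub>R (X - V x)))"
proof -
  note Q = assms(1,2)
  define b where "b = X - Q *v x"
  define g where "g = (\<lambda>s. matrix_exp (s *\<^sub>R Q) *v (cos s *\<^sub>R x + sin s *\<^sub>R b))"
  define w where "w = (\<lambda>s. matrix_exp (s *\<^sub>R Q) *v (cos s *\<^sub>R b - sin s *\<^sub>R x))"
  have unit_iff: "F\<^sub>Q p y = 1 \<longleftrightarrow> norm (y - Q *v p) = 1" if "norm p = 1" for p y
    using navigation_metric_eq_1_iff[of V p y] norm_skew_less_1[OF Q that] by (simp add: F\<^sub>Q_def V_def)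
  have x: "norm x = 1" and b: "norm b = 1" and xb: "x \<bullet> b = 0"
    using assms(5-7) unit_iff[of x X] inner_skew_matrix(2)[OF Q(1), of x]
    by (auto simp: b_def tangent_sphere_def inner_diff_right)
  note flow = skew_flow_of_great_circle[OF Q(1) g_def w_def]
  note g = flow(1-4) flow(5,6)[OF x b xb]
  show ?thesis
  proof
    assume h: "sphere_geodesic F\<^sub>Q \<gamma> \<and> unit_speed F\<^sub>Q \<gamma> \<and> \<gamma> 0 = x \<and> (\<gamma> has_vector_derivative X) (at 0)"
    define \<gamma>\<^sub>1 where "\<gamma>\<^sub>1 = (\<lambda>t. vector_derivative \<gamma> (at t))"
    define u where "u = (\<lambda>t. \<gamma>\<^sub>1 t - Q *v \<gamma> t)"
    have \<gamma>\<^sub>1: "(\<gamma> has_vector_derivative \<gamma>\<^sub>1 t) (at t)" for t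
      using h by (simp add: unit_speed_def \<gamma>\<^sub>1_def vector_derivative_works)
    have "\<gamma> t \<in> sphere 0 1" for t
      using h unfolding sphere_geodesic_def by blast
    then have "norm (\<gamma>\<^sub>1 t - Q *v \<gamma> t) = 1" for t
      using h unit_iff[of "\<gamma> t" "\<gamma>\<^sub>1 t"] by (simp add: unit_speed_def \<gamma>\<^sub>1_def)
    then have acc: "(\<gamma>\<^sub>1 has_vector_derivative Q *v \<gamma>\<^sub>1 s + Q *v u s - \<gamma> s) (at s)" for s
      unfolding u_def using h \<gamma>\<^sub>1 by (intro geodesic_acceleration Q) (auto simp: F\<^sub>Q_def V_def)
    have "(u has_vector_derivative (Q *v \<gamma>\<^sub>1 s + Q *v u s - \<gamma> s) - Q *v \<gamma>\<^sub>1 s) (at s)" for s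
      unfolding u_def
      by (rule has_vector_derivative_diff[OF acc[unfolded u_def] has_vector_derivative_matrix_vector_mult[OF \<gamma>\<^sub>1]])
    then have u: "(u has_vector_derivative Q *v u s - \<gamma> s) (at s)" for s by simp
    have \<gamma>: "(\<gamma> has_vector_derivative Q *v \<gamma> s + u s) (at s)" for s
      using \<gamma>\<^sub>1 by (simp add: u_def)
    have "\<gamma>\<^sub>1 0 = X" using h vector_derivative_at unfolding \<gamma>\<^sub>1_def by blast
    then have "u 0 = w 0" using h by (simp add: u_def g(4) b_def)
    moreover have "\<gamma> 0 = g 0" using h g(3) by simp
    ultimately have "\<gamma> s = g s" for s
      using skew_oscillator_unique[OF Q(1) \<gamma> u g(1,2)] by blast
    then show "\<forall>s. \<gamma> s = matrix_exp (s *\<^sub>R Q) *v (cos s *\<^sub>R x + sin s *\<^sub>R (X - V x))"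
      by (simp add: g_def b_def V_def)
  next
    assume "\<forall>s. \<gamma> s = matrix_exp (s *\<^sub>R Q) *v (cos s *\<^sub>R x + sin s *\<^sub>R (X - V x))"
    then have \<gamma>: "\<gamma> = g" by (auto simp: g_def b_def V_def)
    define g\<^sub>1 where "g\<^sub>1 = (\<lambda>s. Q *v g s + w s)"
    have rel: "g\<^sub>1 s - Q *v g s = w s" for s by (simp add: g\<^sub>1_def)
    have d: "(g has_vector_derivative g\<^sub>1 s) (at s)" for s
      using g(1) by (simp add: g\<^sub>1_def)
    have acc: "(g\<^sub>1 has_vector_derivative Q *v g\<^sub>1 s + Q *v (g\<^sub>1 s - Q *v g s) - g s) (at s)" for s
    proof -
      have "(g\<^sub>1 has_vector_derivative Q *v g\<^sub>1 s + (Q *v w s - g s)) (at s)"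
        unfolding g\<^sub>1_def
        by (intro has_vector_derivative_add g(2) has_vector_derivative_matrix_vector_mult g(1))
      then show ?thesis by (simp add: rel algebra_simps)
    qed
    have "sphere_geodesic F\<^sub>Q g"
      unfolding F\<^sub>Q_def V_def
      by (rule geodesic_if_acceleration[OF Q g(5) d acc]) (simp add: rel g(6))
    moreover have "unit_speed F\<^sub>Q g"
      unfolding unit_speed_def
      using d vector_derivative_at[OF d] unit_iff[OF g(5)] rel g(6)
      by (auto intro: differentiableI_vector)
    moreover have "g\<^sub>1 0 = X" by (simp add: g\<^sub>1_def g(3,4) b_def)
    ultimately show "sphere_geodesic F\<^sub>Q \<gamma> \<and> unit_speed F\<^sub>Q \<gamma> \<and> \<gamma> 0 = x \<and> (\<gamma> has_vector_derivative X) (at 0)"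
      using d[of 0] g(3) unfolding \<gamma> by simp
  qed
qed

end
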